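(* Let $U\subset\mathbb{R}^2$ be open with coordinates $(x,z)$ and let $q:U\to\mathbb{R}$ be a smooth function such that $u=-q_x$ satisfies the Korteweg--de Vries equation $$4u_z=u_{xxx}+12uu_x .$$ Put $$b=q_x-q^2,\qquad 4w=q_{xxx}-4qq_{xx}-2q_x^2+4q^2q_x .$$ On $U\times\mathbb{R}^2$, with coordinates $(m,n)$ on $\mathbb{R}^2$, define the vector fields $$W=\partial_x+(qm+n)\partial_m+(bm-qn)\partial_n,\qquad \tilde W=\partial_x,\qquad \tilde Z=-m\,\partial_n,$$ $$Z=\partial_z+\left(\tfrac{b_x}{2}m-q_xn\right)\partial_m+\left(wm-\tfrac{b_x}{2}n\right)\partial_n,$$ and the volume form $\nu=dx\wedge dz\wedge dm\wedge dn$. Then $$f^2:=\nu(W,\tilde W,Z,\tilde Z)=-m(qm+n),$$ and, where $f^2\neq0$, $f^{-1}W,\ f^{-1}\tilde W,\ f^{-1}Z,\ f^{-1}\tilde Z$ is a normalised null tetrad for a half-flat metric (Ricci-flat with self-dual Weyl tensor), namely $$g=f^2\,(e_W\odot e_{\tilde W}-e_Z\odot e_{\tilde Z}),$$ where $e_W,e_{\tilde W},e_Z,e_{\tilde Z}$ is the coframe dual to $W,\tilde W,Z,\tilde Z$.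
   Context: Subscripts $x,z$ denote partial derivatives. $\odot$ is the symmetrised tensor product of one-forms (its overall constant normalisation is irrelevant). The symbol $f^2$ denotes the function $\nu(W,\tilde W,Z,\tilde Z)$, which may be negative; the metric $g$ depends only on $f^2$. "Half-flat" means: the Ricci tensor of $g$ vanishes and the Weyl tensor of $g$ is self-dual, where the orientation is the one for which the two-forms $f^2 e_W\wedge e_Z$, $f^2(e_W\wedge e_{\tilde W}-e_Z\wedge e_{\tilde Z})$ and $f^2 e_{\tilde W}\wedge e_{\tilde Z}$ are anti-self-dual. The metric $g$ has ultra-hyperbolic signature $(2,2)$.
   Formalization: Half-flatness is proved only for potentials with 4q_z = q_xxx − 6q_x², KdV integrated once in x with zero integration function c(z); where c(z) ≠ 0 the metric is not Ricci-flat (e.g. q = z, u = 0), so the claim as printed is false. *)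

theory Defs
  imports "HOL-Analysis.Analysis"
begin

section \<open>Calculus in coordinates\<close>

definition partial :: "'n::finite \<Rightarrow> (real ^ 'n \<Rightarrow> real) \<Rightarrow> real ^ 'n \<Rightarrow> real" where
  "partial i f p = deriv (\<lambda>t. f (p + t *\<^sub>R axis i 1)) 0"

primrec Ck_on :: "nat \<Rightarrow> (real ^ 'n::finite) set \<Rightarrow> (real ^ 'n \<Rightarrow> real) \<Rightarrow> bool" where
  "Ck_on 0 S f \<longleftrightarrow> continuous_on S f"
| "Ck_on (Suc k) S f \<longleftrightarrow> f differentiable_on S \<and> (\<forall>i. Ck_on k S (partial i f))"

text \<open>Intended for open \<open>S\<close> only: the partial derivatives are two-sided.\<close>

definition smooth_on :: "(real ^ 'n::finite) set \<Rightarrow> (real ^ 'n \<Rightarrow> real) \<Rightarrow> bool" where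
  "smooth_on S f \<longleftrightarrow> (\<forall>k. Ck_on k S f)"

section \<open>Pseudo-Riemannian geometry on open subsets of four-dimensional space\<close>

text \<open>Vectors and one-forms at a point are component vectors, paired by \<open>\<bullet>\<close>; a covariant
  2-tensor \<open>B\<close> is the matrix of its components \<open>B $ i $ j\<close>.\<close>

definition tensor2_apply :: "real ^ 4 ^ 4 \<Rightarrow> real ^ 4 \<Rightarrow> real ^ 4 \<Rightarrow> real" where
  "tensor2_apply B u v = (\<Sum>i\<in>UNIV. \<Sum>j\<in>UNIV. B $ i $ j * u $ i * v $ j)"

definition sym_prod :: "real ^ 4 \<Rightarrow> real ^ 4 \<Rightarrow> real ^ 4 ^ 4" where
  "sym_prod \<alpha> \<beta> = (\<chi> i j. \<alpha> $ i * \<beta> $ j + \<beta> $ i * \<alpha> $ j)"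

definition wedge :: "real ^ 4 \<Rightarrow> real ^ 4 \<Rightarrow> real ^ 4 ^ 4" where
  "wedge \<alpha> \<beta> = (\<chi> i j. \<alpha> $ i * \<beta> $ j - \<beta> $ i * \<alpha> $ j)"

text \<open>The coordinate volume form, equal to 1 on the coordinate basis.\<close>

definition coord_vol :: "real ^ 4 \<Rightarrow> real ^ 4 \<Rightarrow> real ^ 4 \<Rightarrow> real ^ 4 \<Rightarrow> real" where
  "coord_vol a b c d = det (vector [a, b, c, d] :: real ^ 4 ^ 4)"

text \<open>The rows of \<open>X\<close> are the vectors of a frame; the rows of the result are the dual one-forms.\<close>

definition dual_coframe :: "real ^ 4 ^ 4 \<Rightarrow> real ^ 4 ^ 4" where
  "dual_coframe X = (THE E. \<forall>a b. (E $ a) \<bullet> (X $ b) = (if a = b then 1 else 0))"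

definition ultrahyperbolic :: "real ^ 4 ^ 4 \<Rightarrow> bool" where
  "ultrahyperbolic G \<longleftrightarrow> transpose G = G \<and>
     (\<exists>v :: 4 \<Rightarrow> real ^ 4. \<forall>a b. tensor2_apply G (v a) (v b) =
        (if a \<noteq> b then 0 else if a = 1 \<or> a = 2 then 1 else - 1))"

definition ultrahyperbolic_metric_on :: "(real ^ 4) set \<Rightarrow> (real ^ 4 \<Rightarrow> real ^ 4 ^ 4) \<Rightarrow> bool" where
  "ultrahyperbolic_metric_on S g \<longleftrightarrow>
     (\<forall>i j. smooth_on S (\<lambda>p. g p $ i $ j)) \<and> (\<forall>p\<in>S. ultrahyperbolic (g p))"

text \<open>\<open>christoffel g i j k\<close> is $\Gamma^i_{jk}$ and \<open>riemann g i j k l\<close> is $R^i{}_{jkl}$, with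
  $R(\partial_k, \partial_l)\partial_j = R^i{}_{jkl}\partial_i$.\<close>

definition christoffel ::
  "(real ^ 4 \<Rightarrow> real ^ 4 ^ 4) \<Rightarrow> 4 \<Rightarrow> 4 \<Rightarrow> 4 \<Rightarrow> real ^ 4 \<Rightarrow> real" where
  "christoffel g i j k p = (1/2) * (\<Sum>l\<in>UNIV. matrix_inv (g p) $ i $ l *
     (partial j (\<lambda>p'. g p' $ l $ k) p + partial k (\<lambda>p'. g p' $ l $ j) p
      - partial l (\<lambda>p'. g p' $ j $ k) p))"

definition riemann ::
  "(real ^ 4 \<Rightarrow> real ^ 4 ^ 4) \<Rightarrow> 4 \<Rightarrow> 4 \<Rightarrow> 4 \<Rightarrow> 4 \<Rightarrow> real ^ 4 \<Rightarrow> real" where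
  "riemann g i j k l p =
     partial k (christoffel g i l j) p - partial l (christoffel g i k j) p
     + (\<Sum>s\<in>UNIV. christoffel g i k s p * christoffel g s l j p
                 - christoffel g i l s p * christoffel g s k j p)"

definition ricci :: "(real ^ 4 \<Rightarrow> real ^ 4 ^ 4) \<Rightarrow> 4 \<Rightarrow> 4 \<Rightarrow> real ^ 4 \<Rightarrow> real" where
  "ricci g j l p = (\<Sum>k\<in>UNIV. riemann g k j k l p)"

definition scalar_curv :: "(real ^ 4 \<Rightarrow> real ^ 4 ^ 4) \<Rightarrow> real ^ 4 \<Rightarrow> real" where
  "scalar_curv g p = (\<Sum>j\<in>UNIV. \<Sum>l\<in>UNIV. matrix_inv (g p) $ j $ l * ricci g j l p)"

definition riemann_low ::
  "(real ^ 4 \<Rightarrow> real ^ 4 ^ 4) \<Rightarrow> 4 \<Rightarrow> 4 \<Rightarrow> 4 \<Rightarrow> 4 \<Rightarrow> real ^ 4 \<Rightarrow> real" where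
  "riemann_low g i j k l p = (\<Sum>s\<in>UNIV. g p $ i $ s * riemann g s j k l p)"

text \<open>The trace-free part of the Riemann tensor; the constants are those of dimension four.\<close>

definition weyl ::
  "(real ^ 4 \<Rightarrow> real ^ 4 ^ 4) \<Rightarrow> 4 \<Rightarrow> 4 \<Rightarrow> 4 \<Rightarrow> 4 \<Rightarrow> real ^ 4 \<Rightarrow> real" where
  "weyl g i j k l p = riemann_low g i j k l p
     - (1/2) * (g p $ i $ k * ricci g j l p - g p $ i $ l * ricci g j k p
              - g p $ j $ k * ricci g i l p + g p $ j $ l * ricci g i k p)
     + (scalar_curv g p / 6) * (g p $ i $ k * g p $ j $ l - g p $ i $ l * g p $ j $ k)"

text \<open>An orientation is recorded by its sign relative to the coordinate volume form.\<close>

definition orientation_on :: "(real ^ 4) set \<Rightarrow> (real ^ 4 \<Rightarrow> real) \<Rightarrow> bool" where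
  "orientation_on S \<epsilon> \<longleftrightarrow> continuous_on S \<epsilon> \<and> (\<forall>p\<in>S. \<epsilon> p = 1 \<or> \<epsilon> p = - 1)"

definition metric_vol :: "real ^ 4 ^ 4 \<Rightarrow> real \<Rightarrow> 4 \<Rightarrow> 4 \<Rightarrow> 4 \<Rightarrow> 4 \<Rightarrow> real" where
  "metric_vol G \<epsilon> i j k l =
     \<epsilon> * sqrt \<bar>det G\<bar> * coord_vol (axis i 1) (axis j 1) (axis k 1) (axis l 1)"

definition hodge2 :: "real ^ 4 ^ 4 \<Rightarrow> real \<Rightarrow> real ^ 4 ^ 4 \<Rightarrow> real ^ 4 ^ 4" where
  "hodge2 G \<epsilon> B = (\<chi> i j. (1/2) * (\<Sum>k\<in>UNIV. \<Sum>l\<in>UNIV. metric_vol G \<epsilon> i j k l *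
     (matrix_inv G ** B ** transpose (matrix_inv G)) $ k $ l))"

definition self_dual2 :: "real ^ 4 ^ 4 \<Rightarrow> real \<Rightarrow> real ^ 4 ^ 4 \<Rightarrow> bool" where
  "self_dual2 G \<epsilon> B \<longleftrightarrow> hodge2 G \<epsilon> B = B"

definition anti_self_dual2 :: "real ^ 4 ^ 4 \<Rightarrow> real \<Rightarrow> real ^ 4 ^ 4 \<Rightarrow> bool" where
  "anti_self_dual2 G \<epsilon> B \<longleftrightarrow> hodge2 G \<epsilon> B = - B"

definition half_flat_on ::
  "(real ^ 4) set \<Rightarrow> (real ^ 4 \<Rightarrow> real) \<Rightarrow> (real ^ 4 \<Rightarrow> real ^ 4 ^ 4) \<Rightarrow> bool" where
  "half_flat_on S \<epsilon> g \<longleftrightarrow> (\<forall>p\<in>S.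
     (\<forall>i j. ricci g i j p = 0) \<and>
     (\<forall>k l. self_dual2 (g p) (\<epsilon> p) (\<chi> i j. weyl g i j k l p)))"

text \<open>Since the factor \<open>f\<close> with prescribed square \<open>f\<^sup>2\<close> may be imaginary, tetrads are taken in the
  complexified tangent space, with the complex-bilinear extension of the metric.\<close>

definition tensor2_apply_complex :: "real ^ 4 ^ 4 \<Rightarrow> complex ^ 4 \<Rightarrow> complex ^ 4 \<Rightarrow> complex" where
  "tensor2_apply_complex B u v = (\<Sum>i\<in>UNIV. \<Sum>j\<in>UNIV. of_real (B $ i $ j) * u $ i * v $ j)"

definition complex_scale :: "complex \<Rightarrow> real ^ 4 \<Rightarrow> complex ^ 4" where
  "complex_scale c v = (\<chi> i. c * of_real (v $ i))"

definition normalised_null_tetrad ::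
  "real ^ 4 ^ 4 \<Rightarrow> complex ^ 4 \<Rightarrow> complex ^ 4 \<Rightarrow> complex ^ 4 \<Rightarrow> complex ^ 4 \<Rightarrow> bool" where
  "normalised_null_tetrad G W W' Z Z' \<longleftrightarrow> (let h = tensor2_apply_complex G in
     h W W' = 1 \<and> h Z Z' = - 1 \<and>
     h W W = 0 \<and> h W' W' = 0 \<and> h Z Z = 0 \<and> h Z' Z' = 0 \<and>
     h W Z = 0 \<and> h W Z' = 0 \<and> h W' Z = 0 \<and> h W' Z' = 0)"

section \<open>The Korteweg--de Vries equation and the associated metric\<close>

text \<open>Points of \<open>real ^ 2\<close> have coordinates $(x,z)$; points of \<open>real ^ 4\<close> have coordinates
  $(x,z,m,n)$.\<close>

definition kdv_on :: "(real ^ 2) set \<Rightarrow> (real ^ 2 \<Rightarrow> real) \<Rightarrow> bool" where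
  "kdv_on U u \<longleftrightarrow> (\<forall>y\<in>U. 4 * partial 2 u y =
     partial 1 (partial 1 (partial 1 u)) y + 12 * u y * partial 1 u y)"

text \<open>For \<open>u = - q\<^sub>x\<close>, the KdV equation is the \<open>x\<close>-derivative of
  $4q_z = q_{xxx} - 6q_x^2 + c(z)$. The vector fields below commute as required for half-flatness
  only for the potential with $c = 0$; for example \<open>q = z\<close>, which has \<open>u = 0\<close>, gives a metric that is
  not Ricci-flat.\<close>

definition normalised_potential_on :: "(real ^ 2) set \<Rightarrow> (real ^ 2 \<Rightarrow> real) \<Rightarrow> bool" where
  "normalised_potential_on U q \<longleftrightarrow> (\<forall>y\<in>U. 4 * partial 2 q y =
     partial 1 (partial 1 (partial 1 q)) y - 6 * (partial 1 q y)\<^sup>2)"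

definition xz :: "real ^ 4 \<Rightarrow> real ^ 2" where
  "xz p = vector [p $ 1, p $ 2]"

definition kdv_b :: "(real ^ 2 \<Rightarrow> real) \<Rightarrow> real ^ 2 \<Rightarrow> real" where
  "kdv_b q y = partial 1 q y - (q y)\<^sup>2"

definition kdv_w :: "(real ^ 2 \<Rightarrow> real) \<Rightarrow> real ^ 2 \<Rightarrow> real" where
  "kdv_w q y = (partial 1 (partial 1 (partial 1 q)) y - 4 * q y * partial 1 (partial 1 q) y
     - 2 * (partial 1 q y)\<^sup>2 + 4 * (q y)\<^sup>2 * partial 1 q y) / 4"

definition vf_W :: "(real ^ 2 \<Rightarrow> real) \<Rightarrow> real ^ 4 \<Rightarrow> real ^ 4" where
  "vf_W q p = (let m = p $ 3; n = p $ 4; y = xz p in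
     axis 1 1 + (q y * m + n) *\<^sub>R axis 3 1 + (kdv_b q y * m - q y * n) *\<^sub>R axis 4 1)"

definition vf_W' :: "real ^ 4 \<Rightarrow> real ^ 4" where
  "vf_W' p = axis 1 1"

definition vf_Z :: "(real ^ 2 \<Rightarrow> real) \<Rightarrow> real ^ 4 \<Rightarrow> real ^ 4" where
  "vf_Z q p = (let m = p $ 3; n = p $ 4; y = xz p; b\<^sub>x = partial 1 (kdv_b q) y in
     axis 2 1 + (b\<^sub>x / 2 * m - partial 1 q y * n) *\<^sub>R axis 3 1
              + (kdv_w q y * m - b\<^sub>x / 2 * n) *\<^sub>R axis 4 1)"

definition vf_Z' :: "real ^ 4 \<Rightarrow> real ^ 4" where
  "vf_Z' p = - (p $ 3) *\<^sub>R axis 4 1"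

definition f_sq :: "(real ^ 2 \<Rightarrow> real) \<Rightarrow> real ^ 4 \<Rightarrow> real" where
  "f_sq q p = coord_vol (vf_W q p) (vf_W' p) (vf_Z q p) (vf_Z' p)"

definition kdv_coframe :: "(real ^ 2 \<Rightarrow> real) \<Rightarrow> real ^ 4 \<Rightarrow> real ^ 4 ^ 4" where
  "kdv_coframe q p = dual_coframe (vector [vf_W q p, vf_W' p, vf_Z q p, vf_Z' p])"

definition e_W :: "(real ^ 2 \<Rightarrow> real) \<Rightarrow> real ^ 4 \<Rightarrow> real ^ 4" where
  "e_W q p = kdv_coframe q p $ 1"

definition e_W' :: "(real ^ 2 \<Rightarrow> real) \<Rightarrow> real ^ 4 \<Rightarrow> real ^ 4" where
  "e_W' q p = kdv_coframe q p $ 2"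

definition e_Z :: "(real ^ 2 \<Rightarrow> real) \<Rightarrow> real ^ 4 \<Rightarrow> real ^ 4" where
  "e_Z q p = kdv_coframe q p $ 3"

definition e_Z' :: "(real ^ 2 \<Rightarrow> real) \<Rightarrow> real ^ 4 \<Rightarrow> real ^ 4" where
  "e_Z' q p = kdv_coframe q p $ 4"

definition kdv_metric :: "(real ^ 2 \<Rightarrow> real) \<Rightarrow> real ^ 4 \<Rightarrow> real ^ 4 ^ 4" where
  "kdv_metric q p = f_sq q p *\<^sub>R
     (sym_prod (e_W q p) (e_W' q p) - sym_prod (e_Z q p) (e_Z' q p))"

definition kdv_domain :: "(real ^ 2) set \<Rightarrow> (real ^ 2 \<Rightarrow> real) \<Rightarrow> (real ^ 4) set" where
  "kdv_domain U q = {p. xz p \<in> U \<and> f_sq q p \<noteq> 0}"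

text \<open>The sign of the orientation relative to \<open>coord_vol\<close> changes with the sign of \<open>f_sq\<close>, so it is
  specified through the two-forms and not as a fixed sign.\<close>

definition kdv_orientation ::
  "(real ^ 2) set \<Rightarrow> (real ^ 2 \<Rightarrow> real) \<Rightarrow> (real ^ 4 \<Rightarrow> real) \<Rightarrow> bool" where
  "kdv_orientation U q \<epsilon> \<longleftrightarrow> orientation_on (kdv_domain U q) \<epsilon> \<and>
     (\<forall>p\<in>kdv_domain U q. \<forall>B \<in> {f_sq q p *\<^sub>R wedge (e_W q p) (e_Z q p),
         f_sq q p *\<^sub>R (wedge (e_W q p) (e_W' q p) - wedge (e_Z q p) (e_Z' q p)),
         f_sq q p *\<^sub>R wedge (e_W' q p) (e_Z' q p)}.
       anti_self_dual2 (kdv_metric q p) (\<epsilon> p) B)"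

end

theory Submission
  imports Defs
begin

text \<open>The fields come from the zero-curvature form of KdV. With W', Z' for the tilde fields, W
  + s Z' and Z + s W' act on (m, n) by trace-free matrices, s being the spectral parameter. That W
  and Z preserve the coordinate volume and that these two combinations commute for every s amounts
  to six first-order relations between m and the components A, B (of W) and P, Q (of Z). The
  equation for q enters the geometry only through them; the tetrad calculations are otherwise
  rational algebra in m, A, B, P, Q and their derivatives. Only two of the three forms are proved
  parallel. As endomorphisms \<open>\<Sigma>1\<close> and \<open>\<Sigma>2\<close> behave, up to
  scale, like E and H in the anti-self-dual copy of sl(2,R); no nonzero element of it commutes with
  both, so commuting with these two already leaves only self-dual curvature. Since f^2 = - m A may
  have either sign, real square roots of it are avoided: det g = (m A)^2, and the orientation is the
  sign \<open>\<epsilon>\<close> with \<open>\<epsilon> * \<bar>m * A\<bar> = m * A\<close>, which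
  makes the Hodge star rational as well.\<close>

text \<open>The form $\Sigma_1 = f^2 e_W\wedge e_Z = -m\,dm\wedge dz$ is closed, and the KdV equation for the
  normalised potential makes the other two anti-self-dual forms of the tetrad closed as well. Closedness
  of all three forces them to be parallel for the Levi-Civita connection. The curvature, read as a
  two-form with values in endomorphisms, therefore commutes with them, so it is self-dual in the first index pair.
  By the first Bianchi identity such a curvature tensor has zero Ricci contraction, so it coincides
  with its Weyl tensor.\<close>

section \<open>Partial derivatives and smoothness\<close>

text \<open>\<open>partial\<close> is a total function and has some value even where no derivative
  exists. The relational form also asserts existence, so the differentiation rules compose.\<close>

definition has_partial :: "'n::finite \<Rightarrow> (real ^ 'n \<Rightarrow> real) \<Rightarrow> real \<Rightarrow> real ^ 'n \<Rightarrow> bool" where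
  "has_partial i f D p \<longleftrightarrow> ((\<lambda>t. f (p + t *\<^sub>R axis i 1)) has_real_derivative D) (at 0)"

lemma has_partial_imp_partial: "has_partial i f D p \<Longrightarrow> partial i f p = D"
  unfolding has_partial_def partial_def by (rule DERIV_imp_deriv)

lemma has_partial_eq_rhs: "has_partial i f D p \<Longrightarrow> D = E \<Longrightarrow> has_partial i f E p"
  by simp

lemma has_partial_const: "has_partial i (\<lambda>p. c) 0 p"
  unfolding has_partial_def by simp

lemma has_partial_coord: "has_partial i (\<lambda>p. p $ j) (if i = j then 1 else 0) p"
  unfolding has_partial_def
  by (auto simp: axis_def intro!: derivative_eq_intros)

lemma has_partial_add:
  "has_partial i f D p \<Longrightarrow> has_partial i g E p \<Longrightarrow> has_partial i (\<lambda>p. f p + g p) (D + E) p"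
  unfolding has_partial_def by (rule DERIV_add)

lemma has_partial_diff:
  "has_partial i f D p \<Longrightarrow> has_partial i g E p \<Longrightarrow> has_partial i (\<lambda>p. f p - g p) (D - E) p"
  unfolding has_partial_def by (rule DERIV_diff)

lemma has_partial_minus:
  "has_partial i f D p \<Longrightarrow> has_partial i (\<lambda>p. - f p) (- D) p"
  unfolding has_partial_def by (rule DERIV_minus)

lemma has_partial_mult:
  "has_partial i f D p \<Longrightarrow> has_partial i g E p \<Longrightarrow>
    has_partial i (\<lambda>p. f p * g p) (D * g p + f p * E) p"
  unfolding has_partial_def by (auto intro!: derivative_eq_intros)

lemma has_partial_divide:
  "has_partial i f D p \<Longrightarrow> has_partial i g E p \<Longrightarrow> g p \<noteq> 0 \<Longrightarrow>
    has_partial i (\<lambda>p. f p / g p) (D / g p - f p * E / (g p)\<^sup>2) p"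
  unfolding has_partial_def
  by (auto intro!: derivative_eq_intros simp: field_simps power2_eq_square)

lemma has_partial_power2:
  "has_partial i f D p \<Longrightarrow> has_partial i (\<lambda>p. (f p)\<^sup>2) (2 * f p * D) p"
  unfolding has_partial_def by (auto intro!: derivative_eq_intros)

lemma has_partial_sum:
  "(\<And>s. s \<in> I \<Longrightarrow> has_partial i (f s) (D s) p) \<Longrightarrow>
    has_partial i (\<lambda>p. \<Sum>s\<in>I. f s p) (\<Sum>s\<in>I. D s) p"
  unfolding has_partial_def by (rule DERIV_sum)

lemma differentiable_imp_has_partial:
  assumes "f differentiable (at p)"
  shows "has_partial i f (partial i f p) p"
proof -
  obtain f' where f': "(f has_derivative f') (at p)"
    using assms unfolding differentiable_def by blast
  have line: "((\<lambda>t. p + t *\<^sub>R axis i 1) has_derivative (\<lambda>t. t *\<^sub>R axis i 1)) (at (0::real))"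
    by (auto intro!: derivative_eq_intros)
  have "((\<lambda>t. f (p + t *\<^sub>R axis i 1)) has_derivative (\<lambda>t. f' (t *\<^sub>R axis i 1))) (at (0::real))"
    using has_derivative_compose[OF line, of f f'] f' by simp
  then have "(\<lambda>t. f (p + t *\<^sub>R axis i 1)) differentiable (at (0::real))"
    unfolding differentiable_def by blast
  then obtain D where "has_partial i f D p"
    unfolding has_partial_def using real_differentiable_def by blast
  then show ?thesis using has_partial_imp_partial by metis
qed

lemma eventually_line_in_open:
  assumes "open S" "p \<in> S"
  shows "\<forall>\<^sub>F t in nhds (0::real). p + t *\<^sub>R axis i (1::real) \<in> S"
proof -
  have "((\<lambda>t. p + t *\<^sub>R axis i (1::real)) \<longlongrightarrow> p + 0 *\<^sub>R axis i 1) (nhds 0)"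
    by (intro tendsto_intros filterlim_ident)
  then show ?thesis using assms topological_tendstoD by fastforce
qed

lemma partial_cong_on:
  assumes "open S" "p \<in> S" "\<And>x. x \<in> S \<Longrightarrow> f x = g x"
  shows "partial i f p = partial i g p"
  unfolding partial_def
  using eventually_mono[OF eventually_line_in_open[OF assms(1,2), of i] assms(3)]
  by (intro deriv_cong_ev) auto

text \<open>Formulas for derivatives hold only on \<open>S\<close>. This transfer lets such a
  formula replace the actual partial derivative at the next order.\<close>

lemma Ck_on_cong:
  assumes "open S" "\<And>x. x \<in> S \<Longrightarrow> f x = g x" "Ck_on k S f"
  shows "Ck_on k S g"
  using assms(2,3)
proof (induction k arbitrary: f g)
  case 0
  then show ?case by (simp cong: continuous_on_cong)
next
  case (Suc k)
  have "g differentiable_on S"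
    using Suc.prems differentiable_transform_within[where d=1]
    unfolding differentiable_on_def by (metis Ck_on.simps(2) differentiable_on_def zero_less_one)
  moreover have "Ck_on k S (partial i g)" for i
    using Suc.IH[of "partial i f" "partial i g"] Suc.prems partial_cong_on[OF assms(1)]
    by (metis Ck_on.simps(2))
  ultimately show ?case by simp
qed

lemma Ck_on_SucD: "Ck_on (Suc k) S f \<Longrightarrow> Ck_on k S f"
proof (induction k arbitrary: f)
  case 0
  then show ?case using differentiable_imp_continuous_on by auto
next
  case (Suc k)
  then show ?case by (metis Ck_on.simps(2))
qed

section \<open>Closure of the differentiability classes under algebraic operations\<close>

lemma Ck_on_const: "Ck_on k S (\<lambda>p. c)"
proof (induction k arbitrary: c)
  case (Suc k)
  have "partial i (\<lambda>p. c) = (\<lambda>p. 0)" for i :: 'a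
    by (rule ext) (rule has_partial_imp_partial[OF has_partial_const])
  then show ?case using Suc by simp
qed simp

lemma Ck_on_coord: "Ck_on k S (\<lambda>p. p $ j)"
proof (cases k)
  case 0
  then show ?thesis by (auto intro!: continuous_intros)
next
  case (Suc k')
  have "partial i (\<lambda>p. p $ j) = (\<lambda>p. if i = j then 1 else 0)" for i
    by (rule ext) (rule has_partial_imp_partial[OF has_partial_coord])
  then show ?thesis using Suc Ck_on_const
    by (auto intro!: bounded_linear_imp_differentiable_on bounded_linear_vec_nth)
qed

lemma Ck_on_has_partial:
  assumes "open S" "Ck_on (Suc k) S f" "p \<in> S"
  shows "has_partial i f (partial i f p) p"
  by (rule differentiable_imp_has_partial)
    (use assms differentiable_on_eq_differentiable_at[OF assms(1)] in auto)

lemma Ck_on_add: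
  assumes "open S" "Ck_on k S f" "Ck_on k S g"
  shows "Ck_on k S (\<lambda>p. f p + g p)"
  using assms(2,3)
proof (induction k arbitrary: f g)
  case 0
  then show ?case by (auto intro: continuous_on_add)
next
  case (Suc k)
  have "Ck_on k S (partial i (\<lambda>p. f p + g p))" for i
  proof (rule Ck_on_cong[OF assms(1)])
    show "Ck_on k S (\<lambda>p. partial i f p + partial i g p)"
      using Suc by simp
    show "partial i f x + partial i g x = partial i (\<lambda>p. f p + g p) x" if "x \<in> S" for x
      by (intro has_partial_imp_partial[symmetric] has_partial_add
            Ck_on_has_partial[OF assms(1) Suc.prems(1) that]
            Ck_on_has_partial[OF assms(1) Suc.prems(2) that])
  qed
  with Suc.prems show ?case by (auto intro: differentiable_on_add)
qed

lemma Ck_on_mult: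
  assumes "open S" "Ck_on k S f" "Ck_on k S g"
  shows "Ck_on k S (\<lambda>p. f p * g p)"
  using assms(2,3)
proof (induction k arbitrary: f g)
  case 0
  then show ?case by (auto intro: continuous_on_mult)
next
  case (Suc k)
  have "Ck_on k S (partial i (\<lambda>p. f p * g p))" for i
  proof (rule Ck_on_cong[OF assms(1)])
    show "Ck_on k S (\<lambda>p. partial i f p * g p + f p * partial i g p)"
      using Suc.prems Ck_on_SucD by (intro Ck_on_add assms(1) Suc.IH) auto
    show "partial i f x * g x + f x * partial i g x = partial i (\<lambda>p. f p * g p) x" if "x \<in> S" for x
      by (intro has_partial_imp_partial[symmetric] has_partial_mult
            Ck_on_has_partial[OF assms(1) Suc.prems(1) that]
            Ck_on_has_partial[OF assms(1) Suc.prems(2) that])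
  qed
  with Suc.prems show ?case by (auto intro: differentiable_on_mult)
qed

text \<open>The derivative of 1/f is a polynomial in 1/f and the derivative of f, so the induction
  hypothesis for the same function 1/f closes the step.\<close>

lemma Ck_on_inverse:
  assumes "open S" "Ck_on k S f" "\<And>x. x \<in> S \<Longrightarrow> f x \<noteq> 0"
  shows "Ck_on k S (\<lambda>p. 1 / f p)"
  using assms(2)
proof (induction k)
  case 0
  then show ?case using assms(3) by (auto intro!: continuous_intros)
next
  case (Suc k)
  have IH: "Ck_on k S (\<lambda>p. 1 / f p)"
    using Suc Ck_on_SucD by blast
  have "Ck_on k S (partial i (\<lambda>p. 1 / f p))" for i
  proof (rule Ck_on_cong[OF assms(1)])
    show "Ck_on k S (\<lambda>p. (-1) * partial i f p * ((1 / f p) * (1 / f p)))"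
      using Suc.prems by (intro Ck_on_mult assms(1) IH Ck_on_const) auto
    show "(-1) * partial i f x * ((1 / f x) * (1 / f x)) = partial i (\<lambda>p. 1 / f p) x"
      if "x \<in> S" for x
      using has_partial_divide[OF has_partial_const[of i 1]
          Ck_on_has_partial[OF assms(1) Suc.prems that] assms(3)[OF that], THEN has_partial_imp_partial]
      by (simp add: power2_eq_square)
  qed
  moreover have "(\<lambda>p. 1 / f p) differentiable_on S"
    using Suc.prems assms(3) differentiable_inverse[of f]
    by (auto simp: differentiable_on_def divide_inverse)
  ultimately show ?case by simp
qed

lemma smooth_on_const: "smooth_on S (\<lambda>p. c)"
  and smooth_on_coord: "smooth_on S (\<lambda>p. p $ j)"
  by (simp_all add: smooth_on_def Ck_on_const Ck_on_coord)

lemma smooth_on_cong: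
  "open S \<Longrightarrow> smooth_on S f \<Longrightarrow> (\<And>x. x \<in> S \<Longrightarrow> f x = g x) \<Longrightarrow> smooth_on S g"
  unfolding smooth_on_def using Ck_on_cong by blast

lemma smooth_on_add:
  "open S \<Longrightarrow> smooth_on S f \<Longrightarrow> smooth_on S g \<Longrightarrow> smooth_on S (\<lambda>p. f p + g p)"
  by (simp add: smooth_on_def Ck_on_add)

lemma smooth_on_mult:
  "open S \<Longrightarrow> smooth_on S f \<Longrightarrow> smooth_on S g \<Longrightarrow> smooth_on S (\<lambda>p. f p * g p)"
  by (simp add: smooth_on_def Ck_on_mult)

lemma smooth_on_minus:
  "open S \<Longrightarrow> smooth_on S f \<Longrightarrow> smooth_on S (\<lambda>p. - f p)"
  using smooth_on_mult[OF _ smooth_on_const[of S "-1"], of f] by simp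

lemma smooth_on_diff:
  "open S \<Longrightarrow> smooth_on S f \<Longrightarrow> smooth_on S g \<Longrightarrow> smooth_on S (\<lambda>p. f p - g p)"
  using smooth_on_add[of S f "\<lambda>p. - g p"] smooth_on_minus[of S g] by simp

lemma smooth_on_divide:
  assumes "open S" "smooth_on S f" "smooth_on S g" "\<And>x. x \<in> S \<Longrightarrow> g x \<noteq> 0"
  shows "smooth_on S (\<lambda>p. f p / g p)"
proof -
  have "smooth_on S (\<lambda>p. 1 / g p)"
    using assms by (simp add: smooth_on_def Ck_on_inverse)
  then have "smooth_on S (\<lambda>p. f p * (1 / g p))"
    using assms smooth_on_mult by blast
  then show ?thesis by simp
qed

lemma smooth_on_power2:
  "open S \<Longrightarrow> smooth_on S f \<Longrightarrow> smooth_on S (\<lambda>p. (f p)\<^sup>2)"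
  by (simp add: power2_eq_square smooth_on_mult)

lemma smooth_on_sum:
  assumes "open S" "finite I" "\<And>s. s \<in> I \<Longrightarrow> smooth_on S (f s)"
  shows "smooth_on S (\<lambda>p. \<Sum>s\<in>I. f s p)"
  using assms(2,3)
  by (induction I) (auto intro: smooth_on_const smooth_on_add[OF assms(1)])

lemma smooth_on_partial: "smooth_on S f \<Longrightarrow> smooth_on S (partial i f)"
  unfolding smooth_on_def by (metis Ck_on.simps(2))

lemma smooth_on_has_partial:
  "open S \<Longrightarrow> smooth_on S f \<Longrightarrow> p \<in> S \<Longrightarrow> has_partial i f (partial i f p) p"
  unfolding smooth_on_def using Ck_on_has_partial by blast

lemma smooth_on_continuous_on: "smooth_on S f \<Longrightarrow> continuous_on S f"
  unfolding smooth_on_def by (metis Ck_on.simps(1))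

lemma smooth_on_subset:
  assumes "smooth_on S f" "T \<subseteq> S"
  shows "smooth_on T f"
proof -
  have "Ck_on k S f \<Longrightarrow> Ck_on k T f" for k
    using assms(2)
    by (induction k arbitrary: f) (auto intro: continuous_on_subset differentiable_on_subset)
  then show ?thesis using assms unfolding smooth_on_def by blast
qed

lemmas smooth_on_intros = smooth_on_const smooth_on_coord smooth_on_add smooth_on_mult
  smooth_on_minus smooth_on_diff smooth_on_divide smooth_on_power2 smooth_on_sum smooth_on_partial

section \<open>Symmetry of second partial derivatives\<close>

text \<open>\<open>partial\<close> differentiates at parameter 0 only. Moving the base point along
  the line gives the derivative at every parameter, as the mean value theorem requires.\<close>

lemma smooth_on_line_deriv:
  assumes "open S" "smooth_on S f" "p + s *\<^sub>R axis i 1 \<in> S"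
  shows "((\<lambda>t. f (p + t *\<^sub>R axis i 1)) has_real_derivative partial i f (p + s *\<^sub>R axis i 1)) (at s)"
proof -
  have "((\<lambda>t. f (p + s *\<^sub>R axis i 1 + t *\<^sub>R axis i 1)) has_real_derivative
      partial i f (p + s *\<^sub>R axis i 1)) (at 0)"
    using smooth_on_has_partial[OF assms] unfolding has_partial_def .
  then have "((\<lambda>t. f (p + (s + t) *\<^sub>R axis i 1)) has_real_derivative
      partial i f (p + s *\<^sub>R axis i 1)) (at 0)"
    by (simp add: scaleR_left_distrib add.assoc)
  then show ?thesis
    using DERIV_shift[of "\<lambda>t. f (p + t *\<^sub>R axis i 1)" _ 0 s] by (simp add: add.commute)
qed

text \<open>The mean value theorem is applied in direction i to the increment \<open>\<phi>\<close>
  in direction j, and then in direction j to the partial derivative that results. The bound 2 h < r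
  keeps the whole parallelogram in the ball.\<close>

lemma second_difference_mvt:
  assumes "open S" "smooth_on S f" "h > 0" "ball p r \<subseteq> S" "2 * h < r"
  shows "\<exists>x\<in>ball p r. f (p + h *\<^sub>R axis i 1 + h *\<^sub>R axis j 1) - f (p + h *\<^sub>R axis i 1)
           - f (p + h *\<^sub>R axis j 1) + f p = h * h * partial j (partial i f) x"
proof -
  have inb: "p + s *\<^sub>R axis i 1 + t *\<^sub>R axis j 1 \<in> ball p r" if "0 \<le> s" "s \<le> h" "0 \<le> t" "t \<le> h" for s t
  proof -
    have "norm (s *\<^sub>R axis i (1::real) + t *\<^sub>R axis j 1) \<le> norm (s *\<^sub>R axis i (1::real)) + norm (t *\<^sub>R axis j (1::real))"
      by (rule norm_triangle_ineq)
    also have "\<dots> = s + t" using that by (simp add: norm_axis_1)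
    finally have "norm (s *\<^sub>R axis i (1::real) + t *\<^sub>R axis j 1) < r"
      using that assms(5) by linarith
    moreover have "dist p (p + s *\<^sub>R axis i 1 + t *\<^sub>R axis j 1) = norm (s *\<^sub>R axis i (1::real) + t *\<^sub>R axis j 1)"
      unfolding dist_norm by (subst norm_minus_cancel[symmetric]) (simp add: algebra_simps)
    ultimately show ?thesis by simp
  qed
  define \<phi> where "\<phi> s = f ((p + h *\<^sub>R axis j 1) + s *\<^sub>R axis i 1) - f (p + s *\<^sub>R axis i 1)" for s
  have d\<phi>: "(\<phi> has_real_derivative
      partial i f ((p + h *\<^sub>R axis j 1) + s *\<^sub>R axis i 1) - partial i f (p + s *\<^sub>R axis i 1)) (at s)"
    if "0 \<le> s" "s \<le> h" for s
    unfolding \<phi>_def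
    using inb[of s h] inb[of s 0] that assms
    by (intro DERIV_diff smooth_on_line_deriv[OF assms(1,2)]) (auto simp: ac_simps)
  obtain s where s: "0 < s" "s < h" "\<phi> h - \<phi> 0 = (h - 0) *
      (partial i f ((p + h *\<^sub>R axis j 1) + s *\<^sub>R axis i 1) - partial i f (p + s *\<^sub>R axis i 1))"
    using MVT2[OF assms(3), of \<phi>, OF d\<phi>] by blast
  have d: "((\<lambda>t. partial i f ((p + s *\<^sub>R axis i 1) + t *\<^sub>R axis j 1)) has_real_derivative
      partial j (partial i f) ((p + s *\<^sub>R axis i 1) + t *\<^sub>R axis j 1)) (at t)" if "0 \<le> t" "t \<le> h" for t
    using inb[of s t] s that assms
    by (intro smooth_on_line_deriv[OF assms(1)] smooth_on_partial assms(2)) auto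
  obtain t where t: "0 < t" "t < h" "partial i f ((p + s *\<^sub>R axis i 1) + h *\<^sub>R axis j 1)
      - partial i f ((p + s *\<^sub>R axis i 1) + 0 *\<^sub>R axis j 1)
      = (h - 0) * partial j (partial i f) ((p + s *\<^sub>R axis i 1) + t *\<^sub>R axis j 1)"
    using MVT2[OF assms(3), of "\<lambda>t. partial i f ((p + s *\<^sub>R axis i 1) + t *\<^sub>R axis j 1)", OF d] by blast
  have "\<phi> h - \<phi> 0 = h * h * partial j (partial i f) ((p + s *\<^sub>R axis i 1) + t *\<^sub>R axis j 1)"
    using s(3) t(3) by (simp add: ac_simps)
  then show ?thesis
    using inb[of s t] s t unfolding \<phi>_def
    by (intro bexI[of _ "p + s *\<^sub>R axis i 1 + t *\<^sub>R axis j 1"]) (auto simp: ac_simps)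
qed

text \<open>The second difference is symmetric in i and j, so both mixed derivatives take a common
  value, at two points near p. Continuity brings each within half of the supposed gap at p, a
  contradiction.\<close>

lemma partial_commute:
  assumes "open S" "smooth_on S f" "p \<in> S"
  shows "partial i (partial j f) p = partial j (partial i f) p"
proof (rule ccontr)
  let ?a = "partial i (partial j f)" and ?b = "partial j (partial i f)"
  assume ne: "?a p \<noteq> ?b p"
  define e where "e = \<bar>?a p - ?b p\<bar> / 2"
  have "e > 0" using ne by (simp add: e_def)
  have cont: "isCont (partial k (partial l f)) p" for k l
    using smooth_on_continuous_on[OF smooth_on_partial[OF smooth_on_partial[OF assms(2)]]]
      continuous_on_eq_continuous_at[OF assms(1)] assms(3) by blast
  obtain r1 where r1: "r1 > 0" "\<And>x. dist x p < r1 \<Longrightarrow> dist (?a x) (?a p) < e"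
    using cont[of i j] \<open>e > 0\<close> unfolding continuous_at_eps_delta by (metis dist_norm)
  obtain r2 where r2: "r2 > 0" "\<And>x. dist x p < r2 \<Longrightarrow> dist (?b x) (?b p) < e"
    using cont[of j i] \<open>e > 0\<close> unfolding continuous_at_eps_delta by (metis dist_norm)
  obtain r3 where r3: "r3 > 0" "ball p r3 \<subseteq> S"
    using assms(1,3) open_contains_ball by blast
  define r where "r = min r1 (min r2 r3)"
  define h where "h = r / 3"
  have h: "h > 0" "2 * h < r" "ball p r \<subseteq> S"
    using r1 r2 r3 by (auto simp: h_def r_def)
  obtain x where x: "x \<in> ball p r" "f (p + h *\<^sub>R axis i 1 + h *\<^sub>R axis j 1) - f (p + h *\<^sub>R axis i 1)
           - f (p + h *\<^sub>R axis j 1) + f p = h * h * ?b x"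
    using second_difference_mvt[OF assms(1,2) h(1,3,2)] by blast
  obtain y where y: "y \<in> ball p r" "f (p + h *\<^sub>R axis j 1 + h *\<^sub>R axis i 1) - f (p + h *\<^sub>R axis j 1)
           - f (p + h *\<^sub>R axis i 1) + f p = h * h * ?a y"
    using second_difference_mvt[OF assms(1,2) h(1,3,2)] by blast
  have "h * h * ?b x = h * h * ?a y"
    unfolding x(2)[symmetric] y(2)[symmetric] by (simp add: algebra_simps)
  then have "?b x = ?a y" using h(1) by simp
  moreover have "dist (?b x) (?b p) < e" "dist (?a y) (?a p) < e"
    using x(1) y(1) r2(2)[of x] r1(2)[of y] by (auto simp: r_def dist_commute[of p])
  ultimately have "\<bar>?a p - ?b p\<bar> < e + e"
    unfolding dist_real_def by linarith
  then show False by (simp add: e_def)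
qed

section \<open>Functions of the first two coordinates\<close>

lemma xz_line:
  "xz (p + t *\<^sub>R axis 1 1) = xz p + t *\<^sub>R axis 1 1"
  "xz (p + t *\<^sub>R axis 2 1) = xz p + t *\<^sub>R axis 2 1"
  "xz (p + t *\<^sub>R axis 3 1) = xz p"
  "xz (p + t *\<^sub>R axis 4 1) = xz p"
  by (simp_all add: xz_def vec_eq_iff forall_2 axis_def)

lemma partial_xz:
  "partial 1 (\<lambda>p. f (xz p)) p = partial 1 f (xz p)"
  "partial 2 (\<lambda>p. f (xz p)) p = partial 2 f (xz p)"
  "partial 3 (\<lambda>p. f (xz p)) p = 0"
  "partial 4 (\<lambda>p. f (xz p)) p = 0"
  by (simp_all add: partial_def xz_line)

lemma bounded_linear_xz: "bounded_linear xz"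
  unfolding linear_conv_bounded_linear[symmetric]
  by (auto simp: linear_iff xz_def vec_eq_iff forall_2)

lemma continuous_on_xz: "continuous_on S xz"
  by (rule linear_continuous_on[OF bounded_linear_xz])

lemma smooth_on_xz:
  assumes "open U" "open S" "smooth_on U f" "xz ` S \<subseteq> U"
  shows "smooth_on S (\<lambda>p. f (xz p))"
proof -
  have "Ck_on k U f \<Longrightarrow> Ck_on k S (\<lambda>p. f (xz p))" for k
  proof (induction k arbitrary: f)
    case 0
    then show ?case
      using continuous_on_compose2[OF _ continuous_on_xz assms(4)] by simp
  next
    case (Suc k)
    have "(\<lambda>p. f (xz p)) differentiable_on S"
    proof -
      have "(f \<circ> xz) differentiable (at p)" if "p \<in> S" for p
      proof (rule differentiable_chain_at)
        show "xz differentiable at p"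
          by (rule bounded_linear_imp_differentiable[OF bounded_linear_xz])
        show "f differentiable at (xz p)"
          using Suc.prems that assms(4) differentiable_on_eq_differentiable_at[OF assms(1)] by auto
      qed
      then show ?thesis
        unfolding differentiable_on_eq_differentiable_at[OF assms(2)] by (simp add: o_def)
    qed
    moreover have "\<forall>i::4. Ck_on k S (partial i (\<lambda>p. f (xz p)))"
      unfolding forall_4 partial_xz using Suc Ck_on_const[of k S 0] by simp
    ultimately show ?case by simp
  qed
  then show ?thesis using assms(3) unfolding smooth_on_def by blast
qed

section \<open>The Levi-Civita connection\<close>

text \<open>Smoothness of the inverse is an assumption because the inverse is an explicit matrix in
  the application, where it is read off entry by entry.\<close>

locale smooth_metric =
  fixes S :: "(real ^ 4) set" and g :: "real ^ 4 \<Rightarrow> real ^ 4 ^ 4"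
  assumes open_S: "open S"
    and smooth_g: "\<And>i j. smooth_on S (\<lambda>p. g p $ i $ j)"
    and smooth_inv: "\<And>i j. smooth_on S (\<lambda>p. matrix_inv (g p) $ i $ j)"
    and sym_g: "\<And>p i j. p \<in> S \<Longrightarrow> g p $ i $ j = g p $ j $ i"
    and inv_g: "\<And>p. p \<in> S \<Longrightarrow> matrix_inv (g p) ** g p = mat 1"
begin

lemma smooth_christoffel: "smooth_on S (christoffel g i j k)"
  unfolding christoffel_def[abs_def]
  by (intro smooth_on_intros open_S smooth_g smooth_inv finite)

lemma christoffel_has_partial:
  "p \<in> S \<Longrightarrow> has_partial l (christoffel g i j k) (partial l (christoffel g i j k) p) p"
  by (rule smooth_on_has_partial[OF open_S smooth_christoffel])

lemma partial_g_sym: "p \<in> S \<Longrightarrow> partial k (\<lambda>p. g p $ i $ j) p = partial k (\<lambda>p. g p $ j $ i) p"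
  by (rule partial_cong_on[OF open_S]) (auto intro: sym_g)

lemma christoffel_sym: "p \<in> S \<Longrightarrow> christoffel g i j k p = christoffel g i k j p"
  unfolding christoffel_def
  by (simp add: partial_g_sym[of p _ j k] add.commute)

lemma partial_christoffel_sym:
  "p \<in> S \<Longrightarrow> partial l (christoffel g i j k) p = partial l (christoffel g i k j) p"
  by (rule partial_cong_on[OF open_S]) (auto intro: christoffel_sym)

lemma lower_christoffel:
  assumes "p \<in> S"
  shows "(\<Sum>s\<in>UNIV. g p $ i $ s * christoffel g s j k p) =
    (1/2) * (partial j (\<lambda>p. g p $ i $ k) p + partial k (\<lambda>p. g p $ i $ j) p
      - partial i (\<lambda>p. g p $ j $ k) p)"
proof -
  let ?h = "matrix_inv (g p)"
  define L where "L l = (1/2) * (partial j (\<lambda>p. g p $ l $ k) p + partial k (\<lambda>p. g p $ l $ j) p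
      - partial l (\<lambda>p. g p $ j $ k) p)" for l
  have "g p ** ?h = mat 1"
    using inv_g[OF assms] matrix_left_right_inverse by blast
  then have gh: "(\<Sum>s\<in>UNIV. g p $ i $ s * ?h $ s $ l) = (if i = l then 1 else 0)" for l
    unfolding vec_eq_iff matrix_matrix_mult_def mat_def by simp
  have C: "christoffel g s j k p = (\<Sum>l\<in>UNIV. ?h $ s $ l * L l)" for s
    unfolding christoffel_def L_def sum_distrib_left by (rule sum.cong) simp_all
  have "(\<Sum>s\<in>UNIV. g p $ i $ s * christoffel g s j k p) =
      (\<Sum>s\<in>UNIV. \<Sum>l\<in>UNIV. g p $ i $ s * ?h $ s $ l * L l)"
    unfolding C sum_distrib_left by (simp only: mult.assoc)
  also have "\<dots> = (\<Sum>l\<in>UNIV. \<Sum>s\<in>UNIV. g p $ i $ s * ?h $ s $ l * L l)"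
    by (rule sum.swap)
  also have "\<dots> = (\<Sum>l\<in>UNIV. (if i = l then 1 else 0) * L l)"
    by (simp only: sum_distrib_right[symmetric] gh)
  also have "\<dots> = L i"
    by (simp add: if_distrib[of "\<lambda>x. x * _"] cong: if_cong)
  finally show ?thesis unfolding L_def .
qed

text \<open>Vanishing covariant derivative of a covariant 2-tensor in coordinates. No symmetry of
  \<open>B\<close> is imposed, so the notion serves for the metric and for two-forms alike.\<close>

definition parallel :: "(4 \<Rightarrow> 4 \<Rightarrow> real ^ 4 \<Rightarrow> real) \<Rightarrow> bool" where
  "parallel B \<longleftrightarrow> (\<forall>p\<in>S. \<forall>i j k. partial k (B i j) p =
     (\<Sum>s\<in>UNIV. christoffel g s k i p * B s j p + christoffel g s k j p * B i s p))"

lemma parallel_metric: "parallel (\<lambda>i j p. g p $ i $ j)"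
  unfolding parallel_def
proof (intro ballI allI)
  fix p i j k assume p: "p \<in> S"
  have "(\<Sum>s\<in>UNIV. christoffel g s k i p * g p $ s $ j + christoffel g s k j p * g p $ i $ s) =
     (\<Sum>s\<in>UNIV. g p $ j $ s * christoffel g s k i p) + (\<Sum>s\<in>UNIV. g p $ i $ s * christoffel g s k j p)"
    by (simp add: sum.distrib sym_g[OF p, of _ j] mult.commute)
  also have "\<dots> = partial k (\<lambda>p. g p $ i $ j) p"
    unfolding lower_christoffel[OF p]
    using partial_g_sym[OF p, of k i j] partial_g_sym[OF p, of i j k] partial_g_sym[OF p, of j i k]
    by (simp add: field_simps)
  finally show "partial k (\<lambda>p. g p $ i $ j) p = (\<Sum>s\<in>UNIV. christoffel g s k i p * g p $ s $ j
      + christoffel g s k j p * g p $ i $ s)" ..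
qed

text \<open>Integrability condition of the equation for a parallel tensor: second partial
  derivatives of \<open>B\<close> commute, and the antisymmetrised derivative of the right-hand side
  \<open>F\<close> is the action of the curvature on \<open>B\<close>.\<close>

lemma parallel_curvature:
  assumes par: "parallel B" and smB: "\<And>i j. smooth_on S (B i j)" and p: "p \<in> S"
  shows "(\<Sum>s\<in>UNIV. riemann g s i k l p * B s j p + riemann g s j k l p * B i s p) = 0"
proof -
  let ?\<Gamma> = "christoffel g"
  define F where "F k i j p = (\<Sum>s\<in>UNIV. ?\<Gamma> s k i p * B s j p + ?\<Gamma> s k j p * B i s p)" for k i j p
  have F: "partial k (B i j) p = F k i j p" if "p \<in> S" for k i j p
    using par that unfolding parallel_def F_def by blast
  have dF: "partial l (F k i j) p = (\<Sum>s\<in>UNIV.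
      (partial l (?\<Gamma> s k i) p * B s j p + ?\<Gamma> s k i p * F l s j p)
      + (partial l (?\<Gamma> s k j) p * B i s p + ?\<Gamma> s k j p * F l i s p))" for k l i j
  proof -
    have hB: "has_partial l (B i j) (F l i j p) p" for i j
      using smooth_on_has_partial[OF open_S smB p, of l i j] F[OF p] by simp
    show ?thesis
      unfolding F_def[of k, abs_def]
      by (intro has_partial_imp_partial has_partial_sum has_partial_add has_partial_mult
          christoffel_has_partial p hB)
  qed
  have "partial k (F l i j) p = partial k (partial l (B i j)) p" for k l i j
    by (rule partial_cong_on[OF open_S p]) (simp add: F)
  then have "partial k (F l i j) p - partial l (F k i j) p = 0"
    using partial_commute[OF open_S smB p] by simp
  moreover have "partial k (F l i j) p - partial l (F k i j) p =
      (\<Sum>s\<in>UNIV. riemann g s i k l p * B s j p + riemann g s j k l p * B i s p)"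
  proof -
    \<comment> \<open>\<open>Y\<close> collects the terms whose two Christoffel symbols act on
      different indices of \<open>B\<close>. They contribute Y k l + Y l k, which is symmetric in k
      and l and drops out of the difference.\<close>
    define Y where "Y k l = (\<Sum>s\<in>UNIV. \<Sum>t\<in>UNIV. ?\<Gamma> s l i p * ?\<Gamma> t k j p * B s t p)" for k l
    have first: "(\<Sum>s\<in>UNIV. ?\<Gamma> s l i p * F k s j p) =
        (\<Sum>s\<in>UNIV. (\<Sum>t\<in>UNIV. ?\<Gamma> s k t p * ?\<Gamma> t l i p) * B s j p) + Y k l" for k l
    proof -
      have "(\<Sum>s\<in>UNIV. \<Sum>t\<in>UNIV. ?\<Gamma> s l i p * (?\<Gamma> t k s p * B t j p)) =
          (\<Sum>t\<in>UNIV. \<Sum>s\<in>UNIV. ?\<Gamma> s l i p * (?\<Gamma> t k s p * B t j p))"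
        by (rule sum.swap)
      then show ?thesis
        unfolding F_def Y_def
        by (simp add: sum.distrib sum_distrib_left sum_distrib_right distrib_left ac_simps)
    qed
    have second: "(\<Sum>s\<in>UNIV. ?\<Gamma> s l j p * F k i s p) =
        (\<Sum>s\<in>UNIV. (\<Sum>t\<in>UNIV. ?\<Gamma> s k t p * ?\<Gamma> t l j p) * B i s p) + Y l k" for k l
    proof -
      have "(\<Sum>s\<in>UNIV. \<Sum>t\<in>UNIV. ?\<Gamma> s l j p * (?\<Gamma> t k s p * B i t p)) =
          (\<Sum>t\<in>UNIV. \<Sum>s\<in>UNIV. ?\<Gamma> s l j p * (?\<Gamma> t k s p * B i t p))"
        by (rule sum.swap)
      moreover have "(\<Sum>s\<in>UNIV. \<Sum>t\<in>UNIV. ?\<Gamma> s l j p * (?\<Gamma> t k i p * B t s p)) =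
          (\<Sum>t\<in>UNIV. \<Sum>s\<in>UNIV. ?\<Gamma> s l j p * (?\<Gamma> t k i p * B t s p))"
        by (rule sum.swap)
      ultimately show ?thesis
        unfolding F_def Y_def
        by (simp add: sum.distrib sum_distrib_left sum_distrib_right distrib_left ac_simps)
    qed
    show ?thesis
      unfolding dF sum.distrib first second riemann_def
      by (simp add: sum.distrib sum_subtractf left_diff_distrib distrib_right)
  qed
  ultimately show ?thesis by simp
qed

text \<open>The metric is itself parallel, so this is the integrability condition with B =
  g.\<close>

lemma riemann_low_antisym:
  assumes p: "p \<in> S"
  shows "riemann_low g i j k l p = - riemann_low g j i k l p"
proof -
  have "(\<Sum>s\<in>UNIV. riemann g s i k l p * g p $ s $ j + riemann g s j k l p * g p $ i $ s) = 0"
    by (rule parallel_curvature[OF parallel_metric smooth_g p])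
  moreover have "(\<Sum>s\<in>UNIV. riemann g s i k l p * g p $ s $ j) = riemann_low g j i k l p"
    "(\<Sum>s\<in>UNIV. riemann g s j k l p * g p $ i $ s) = riemann_low g i j k l p"
    unfolding riemann_low_def by (simp_all add: sym_g[OF p, of _ j] mult.commute)
  ultimately show ?thesis by (simp add: sum.distrib)
qed

lemma riemann_bianchi:
  assumes p: "p \<in> S"
  shows "riemann g i j k l p + riemann g i k l j p + riemann g i l j k p = 0"
  unfolding riemann_def
  by (simp add: sum_subtractf christoffel_sym[OF p] partial_christoffel_sym[OF p])

lemma riemann_low_bianchi:
  assumes p: "p \<in> S"
  shows "riemann_low g i j k l p + riemann_low g i k l j p + riemann_low g i l j k p = 0"
proof -
  have "riemann_low g i j k l p + riemann_low g i k l j p + riemann_low g i l j k p =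
      (\<Sum>s\<in>UNIV. g p $ i $ s * (riemann g s j k l p + riemann g s k l j p + riemann g s l j k p))"
    unfolding riemann_low_def by (simp only: sum.distrib distrib_left)
  then show ?thesis by (simp add: riemann_bianchi[OF p])
qed

end

section \<open>Hodge duality\<close>

lemma vector_4 [simp]:
  "(vector [w, x, y, z] :: 'a::zero ^ 4) $ 1 = w"
  "(vector [w, x, y, z] :: 'a::zero ^ 4) $ 2 = x"
  "(vector [w, x, y, z] :: 'a::zero ^ 4) $ 3 = y"
  "(vector [w, x, y, z] :: 'a::zero ^ 4) $ 4 = z"
  unfolding vector_def by simp_all

lemma det_4:
  "det (A :: 'a::comm_ring_1 ^ 4 ^ 4) =
    A$1$1 * A$2$2 * A$3$3 * A$4$4 - A$1$1 * A$2$2 * A$3$4 * A$4$3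
  - A$1$1 * A$2$3 * A$3$2 * A$4$4 + A$1$1 * A$2$3 * A$3$4 * A$4$2
  + A$1$1 * A$2$4 * A$3$2 * A$4$3 - A$1$1 * A$2$4 * A$3$3 * A$4$2
  - A$1$2 * A$2$1 * A$3$3 * A$4$4 + A$1$2 * A$2$1 * A$3$4 * A$4$3
  + A$1$2 * A$2$3 * A$3$1 * A$4$4 - A$1$2 * A$2$3 * A$3$4 * A$4$1
  - A$1$2 * A$2$4 * A$3$1 * A$4$3 + A$1$2 * A$2$4 * A$3$3 * A$4$1
  + A$1$3 * A$2$1 * A$3$2 * A$4$4 - A$1$3 * A$2$1 * A$3$4 * A$4$2
  - A$1$3 * A$2$2 * A$3$1 * A$4$4 + A$1$3 * A$2$2 * A$3$4 * A$4$1
  + A$1$3 * A$2$4 * A$3$1 * A$4$2 - A$1$3 * A$2$4 * A$3$2 * A$4$1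
  - A$1$4 * A$2$1 * A$3$2 * A$4$3 + A$1$4 * A$2$1 * A$3$3 * A$4$2
  + A$1$4 * A$2$2 * A$3$1 * A$4$3 - A$1$4 * A$2$2 * A$3$3 * A$4$1
  - A$1$4 * A$2$3 * A$3$1 * A$4$2 + A$1$4 * A$2$3 * A$3$2 * A$4$1"
proof -
  have f1234: "finite {2::4, 3, 4}" "1 \<notin> {2::4, 3, 4}" by auto
  have f234: "finite {3::4, 4}" "2 \<notin> {3::4, 4}" by auto
  have f34: "finite {4::4}" "3 \<notin> {4::4}" by auto
  show ?thesis
    unfolding det_def UNIV_4
    unfolding sum_over_permutations_insert[OF f1234]
    unfolding sum_over_permutations_insert[OF f234]
    unfolding sum_over_permutations_insert[OF f34]
    unfolding permutes_sing
    by (simp add: sign_swap_id permutation_swap_id permutation_compose sign_compose sign_id swap_id_eq)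
qed

lemma coord_vol_axes:
  "coord_vol a b (axis 1 1) (axis 2 1) = a $ 3 * b $ 4 - a $ 4 * b $ 3"
  "coord_vol a b (axis 2 1) (axis 1 1) = a $ 4 * b $ 3 - a $ 3 * b $ 4"
  "coord_vol a b (axis 1 1) (axis 3 1) = a $ 4 * b $ 2 - a $ 2 * b $ 4"
  "coord_vol a b (axis 3 1) (axis 1 1) = a $ 2 * b $ 4 - a $ 4 * b $ 2"
  "coord_vol a b (axis 1 1) (axis 4 1) = a $ 2 * b $ 3 - a $ 3 * b $ 2"
  "coord_vol a b (axis 4 1) (axis 1 1) = a $ 3 * b $ 2 - a $ 2 * b $ 3"
  "coord_vol a b (axis 2 1) (axis 3 1) = a $ 1 * b $ 4 - a $ 4 * b $ 1"
  "coord_vol a b (axis 3 1) (axis 2 1) = a $ 4 * b $ 1 - a $ 1 * b $ 4"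
  "coord_vol a b (axis 2 1) (axis 4 1) = a $ 3 * b $ 1 - a $ 1 * b $ 3"
  "coord_vol a b (axis 4 1) (axis 2 1) = a $ 1 * b $ 3 - a $ 3 * b $ 1"
  "coord_vol a b (axis 3 1) (axis 4 1) = a $ 1 * b $ 2 - a $ 2 * b $ 1"
  "coord_vol a b (axis 4 1) (axis 3 1) = a $ 2 * b $ 1 - a $ 1 * b $ 2"
  "coord_vol a b c c = 0"
  unfolding coord_vol_def det_4 by (simp_all add: axis_def)

lemma levi_civita_sum:
  fixes F :: "4 \<Rightarrow> 4 \<Rightarrow> real"
  defines "L i j \<equiv> \<Sum>k\<in>UNIV. \<Sum>l\<in>UNIV.
    coord_vol (axis i 1) (axis j 1) (axis k 1) (axis l 1) * F k l"
  shows "L 1 2 = F 3 4 - F 4 3" "L 2 1 = F 4 3 - F 3 4"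
    "L 1 3 = F 4 2 - F 2 4" "L 3 1 = F 2 4 - F 4 2"
    "L 1 4 = F 2 3 - F 3 2" "L 4 1 = F 3 2 - F 2 3"
    "L 2 3 = F 1 4 - F 4 1" "L 3 2 = F 4 1 - F 1 4"
    "L 2 4 = F 3 1 - F 1 3" "L 4 2 = F 1 3 - F 3 1"
    "L 3 4 = F 1 2 - F 2 1" "L 4 3 = F 2 1 - F 1 2"
    "L 1 1 = 0" "L 2 2 = 0" "L 3 3 = 0" "L 4 4 = 0"
  unfolding L_def sum_4 coord_vol_axes by (simp_all add: axis_def)

lemma hodge2_nth:
  "hodge2 G \<epsilon> B $ i $ j = \<epsilon> * sqrt \<bar>det G\<bar> / 2 *
    (\<Sum>k\<in>UNIV. \<Sum>l\<in>UNIV. coord_vol (axis i 1) (axis j 1) (axis k 1) (axis l 1) *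
      (matrix_inv G ** B ** transpose (matrix_inv G)) $ k $ l)"
  unfolding hodge2_def metric_vol_def by (simp add: sum_distrib_left mult.assoc)

lemma matrix_inv_eqI:
  fixes G H :: "real ^ 'n ^ 'n"
  assumes "G ** H = mat 1"
  shows "matrix_inv G = H"
proof -
  have "H ** G = mat 1" using assms matrix_left_right_inverse by blast
  moreover have "G ** matrix_inv G = mat 1 \<and> matrix_inv G ** G = mat 1"
    unfolding matrix_inv_def by (rule someI[of _ H]) (use assms calculation in simp)
  ultimately show ?thesis by (metis matrix_mul_assoc matrix_mul_lid matrix_mul_rid)
qed

context smooth_metric
begin

lemma inverse_sym: "p \<in> S \<Longrightarrow> matrix_inv (g p) $ i $ j = matrix_inv (g p) $ j $ i"
proof -
  assume p: "p \<in> S"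
  have "transpose (g p) = g p"
    using sym_g[OF p] by (simp add: vec_eq_iff transpose_def)
  then have "g p ** transpose (matrix_inv (g p)) = mat 1"
    by (metis inv_g[OF p] matrix_transpose_mul transpose_mat)
  then have "matrix_inv (g p) = transpose (matrix_inv (g p))"
    by (rule matrix_inv_eqI)
  then have "matrix_inv (g p) $ i $ j = transpose (matrix_inv (g p)) $ i $ j"
    by simp
  then show ?thesis by (simp add: transpose_def)
qed

section \<open>Algebraic symmetries of the curvature tensor\<close>

lemma riemann_raise:
  assumes p: "p \<in> S"
  shows "riemann g s j k l p = (\<Sum>i\<in>UNIV. matrix_inv (g p) $ s $ i * riemann_low g i j k l p)"
proof -
  let ?h = "matrix_inv (g p)"
  have hg: "(\<Sum>i\<in>UNIV. ?h $ s $ i * g p $ i $ t) = (if s = t then 1 else 0)" for t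
    using inv_g[OF p] unfolding vec_eq_iff matrix_matrix_mult_def mat_def by simp
  have "(\<Sum>i\<in>UNIV. ?h $ s $ i * riemann_low g i j k l p) =
      (\<Sum>i\<in>UNIV. \<Sum>t\<in>UNIV. ?h $ s $ i * g p $ i $ t * riemann g t j k l p)"
    unfolding riemann_low_def sum_distrib_left by (simp only: mult.assoc)
  also have "\<dots> = (\<Sum>t\<in>UNIV. \<Sum>i\<in>UNIV. ?h $ s $ i * g p $ i $ t * riemann g t j k l p)"
    by (rule sum.swap)
  also have "\<dots> = (\<Sum>t\<in>UNIV. (if s = t then 1 else 0) * riemann g t j k l p)"
    by (simp only: sum_distrib_right[symmetric] hg)
  also have "\<dots> = riemann g s j k l p"
    by (simp add: if_distrib[of "\<lambda>x. x * _"] cong: if_cong)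
  finally show ?thesis ..
qed

lemma riemann_low_antisym2: "riemann_low g i j k l p = - riemann_low g i j l k p"
  unfolding riemann_low_def riemann_def sum_negf[symmetric]
  by (rule sum.cong[OF refl]) (simp add: sum_subtractf algebra_simps)

text \<open>The four Bianchi identities, one for each choice of the leading index, combine linearly
  with the antisymmetries in both pairs.\<close>

lemma riemann_low_pair_sym:
  assumes p: "p \<in> S"
  shows "riemann_low g i j k l p = riemann_low g k l i j p"
  using riemann_low_bianchi[OF p, of i j k l] riemann_low_bianchi[OF p, of j k l i]
    riemann_low_bianchi[OF p, of k l i j] riemann_low_bianchi[OF p, of l i j k]
    riemann_low_antisym[OF p, of i j k l] riemann_low_antisym[OF p, of k l i j]
    riemann_low_antisym[OF p, of j k l i] riemann_low_antisym[OF p, of l i j k]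
    riemann_low_antisym[OF p, of j l i k] riemann_low_antisym[OF p, of i k l j]
    riemann_low_antisym2[of i j k l p] riemann_low_antisym2[of k l i j p]
    riemann_low_antisym2[of i k l j p] riemann_low_antisym2[of k i j l p]
    riemann_low_antisym2[of l i j k p] riemann_low_antisym2[of l j k i p]
    riemann_low_antisym2[of j k l i p] riemann_low_antisym2[of j l i k p]
    riemann_low_antisym2[of i l j k p] riemann_low_antisym2[of j i k l p]
    riemann_low_antisym2[of k j l i p] riemann_low_antisym2[of l k i j p]
  by linarith

text \<open>Pair symmetry moves the cyclic sum from the last three slots to the first three, where
  the contraction for the Ricci tensor needs it.\<close>

lemma riemann_low_bianchi3:
  assumes p: "p \<in> S"
  shows "riemann_low g i j k l p + riemann_low g j k i l p + riemann_low g k i j l p = 0"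
  using riemann_low_bianchi[OF p, of l k j i]
    riemann_low_pair_sym[OF p, of i j k l] riemann_low_pair_sym[OF p, of j k i l]
    riemann_low_pair_sym[OF p, of k i j l]
    riemann_low_antisym[OF p, of k l i j] riemann_low_antisym[OF p, of i l j k]
    riemann_low_antisym[OF p, of j l k i]
    riemann_low_antisym2[of l k j i p] riemann_low_antisym2[of l i k j p]
    riemann_low_antisym2[of l j i k p]
  by linarith

text \<open>Up to a factor, self-duality in the first index pair turns the Ricci contraction into a
  contraction of \<open>R\<^sub>a\<^sub>b\<^sub>k\<^sub>l\<close> with the volume form over \<open>a, b, k\<close>, which is zero by the first Bianchi
  identity.\<close>

lemma self_dual_riemann_imp_ricci_flat:
  assumes p: "p \<in> S"
    and sd: "\<And>k l. self_dual2 (g p) \<epsilon> (\<chi> i j. riemann_low g i j k l p)"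
  shows "ricci g j l p = 0"
proof -
  let ?h = "matrix_inv (g p)"
  let ?R = "\<lambda>a b k. riemann_low g a b k l p"
  define c where "c = \<epsilon> * sqrt \<bar>det (g p)\<bar> / 2"
  define U where "U k a b = (?h ** (\<chi> i j. ?R i j k) ** transpose ?h) $ a $ b" for k a b
  \<comment> \<open>\<open>V\<close> is the curvature with its first three slots raised, the third
    one put in front; l stays fixed. In this form the Bianchi identity becomes a cyclic identity in
    i, a, b.\<close>
  define V where "V i a b = (\<Sum>k\<in>UNIV. ?h $ k $ i * U k a b)" for i a b
  have U: "U k a b = (\<Sum>q\<in>UNIV. \<Sum>r\<in>UNIV. ?h $ a $ q * ?h $ b $ r * ?R q r k)" for k a b
  proof -
    have "U k a b = (\<Sum>r\<in>UNIV. \<Sum>q\<in>UNIV. ?h $ a $ q * ?h $ b $ r * ?R q r k)"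
      unfolding U_def matrix_matrix_mult_def transpose_def
      by (simp add: sum_distrib_left sum_distrib_right ac_simps)
    then show ?thesis by (subst sum.swap)
  qed
  have V3: "V i a b = (\<Sum>k\<in>UNIV. \<Sum>q\<in>UNIV. \<Sum>r\<in>UNIV. ?h $ k $ i * ?h $ a $ q * ?h $ b $ r * ?R q r k)"
    for i a b
    unfolding V_def U by (simp add: sum_distrib_left mult.assoc)
  have V_antisym: "V i b a = - V i a b" for i a b
  proof -
    have "U k b a = - U k a b" for k
    proof -
      have "U k b a = (\<Sum>r\<in>UNIV. \<Sum>q\<in>UNIV. ?h $ b $ q * ?h $ a $ r * ?R q r k)"
        unfolding U by (rule sum.swap)
      also have "\<dots> = (\<Sum>r\<in>UNIV. \<Sum>q\<in>UNIV. - (?h $ a $ r * ?h $ b $ q * ?R r q k))"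
        by (intro sum.cong refl) (subst riemann_low_antisym[OF p], simp)
      also have "\<dots> = - U k a b" unfolding U by (simp add: sum_negf)
      finally show ?thesis .
    qed
    then show ?thesis unfolding V_def by (simp add: sum_negf)
  qed
  have V_cyclic: "V i a b + V a b i + V b i a = 0" for i a b
  proof -
    let ?w = "\<lambda>k q r. ?h $ k $ i * ?h $ a $ q * ?h $ b $ r"
    have "V a b i = (\<Sum>q\<in>UNIV. \<Sum>r\<in>UNIV. \<Sum>k\<in>UNIV. ?w k q r * ?R r k q)"
      unfolding V3 by (simp add: inverse_sym[OF p, of _ a] inverse_sym[OF p, of i] ac_simps)
    also have "\<dots> = (\<Sum>q\<in>UNIV. \<Sum>k\<in>UNIV. \<Sum>r\<in>UNIV. ?w k q r * ?R r k q)"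
      by (intro sum.cong refl sum.swap)
    also have "\<dots> = (\<Sum>k\<in>UNIV. \<Sum>q\<in>UNIV. \<Sum>r\<in>UNIV. ?w k q r * ?R r k q)"
      by (rule sum.swap)
    finally have 1: "V a b i = (\<Sum>k\<in>UNIV. \<Sum>q\<in>UNIV. \<Sum>r\<in>UNIV. ?w k q r * ?R r k q)" .
    have "V b i a = (\<Sum>r\<in>UNIV. \<Sum>k\<in>UNIV. \<Sum>q\<in>UNIV. ?w k q r * ?R k q r)"
      unfolding V3 by (simp add: inverse_sym[OF p, of _ b] inverse_sym[OF p, of i] ac_simps)
    also have "\<dots> = (\<Sum>k\<in>UNIV. \<Sum>r\<in>UNIV. \<Sum>q\<in>UNIV. ?w k q r * ?R k q r)"
      by (rule sum.swap)
    also have "\<dots> = (\<Sum>k\<in>UNIV. \<Sum>q\<in>UNIV. \<Sum>r\<in>UNIV. ?w k q r * ?R k q r)"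
      by (intro sum.cong refl sum.swap)
    finally have 2: "V b i a = (\<Sum>k\<in>UNIV. \<Sum>q\<in>UNIV. \<Sum>r\<in>UNIV. ?w k q r * ?R k q r)" .
    have "V i a b + V a b i + V b i a =
      (\<Sum>k\<in>UNIV. \<Sum>q\<in>UNIV. \<Sum>r\<in>UNIV. ?w k q r * (?R q r k + ?R r k q + ?R k q r))"
      unfolding 1 2 V3[of i a b] sum.distrib[symmetric] distrib_left by simp
    then show ?thesis by (simp add: riemann_low_bianchi3[OF p])
  qed
  have R: "?R i j k = c * (\<Sum>a\<in>UNIV. \<Sum>b\<in>UNIV.
      coord_vol (axis i 1) (axis j 1) (axis a 1) (axis b 1) * U k a b)" for i k
    using sd[of k l] unfolding self_dual2_def vec_eq_iff hodge2_nth U_def c_def by simp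
  have "ricci g j l p = (\<Sum>k\<in>UNIV. \<Sum>i\<in>UNIV. ?h $ k $ i * ?R i j k)"
    unfolding ricci_def by (simp add: riemann_raise[OF p])
  also have "\<dots> = (\<Sum>i\<in>UNIV. \<Sum>k\<in>UNIV. ?h $ k $ i * ?R i j k)"
    by (rule sum.swap)
  also have "\<dots> = (\<Sum>i\<in>UNIV. c * (\<Sum>a\<in>UNIV. \<Sum>b\<in>UNIV.
      coord_vol (axis i 1) (axis j 1) (axis a 1) (axis b 1) * V i a b))"
  proof (rule sum.cong[OF refl])
    fix i :: 4
    let ?e = "\<lambda>a b. coord_vol (axis i 1) (axis j 1) (axis a 1) (axis b 1)"
    have "(\<Sum>k\<in>UNIV. ?h $ k $ i * ?R i j k) =
        (\<Sum>k\<in>UNIV. \<Sum>a\<in>UNIV. \<Sum>b\<in>UNIV. c * (?e a b * (?h $ k $ i * U k a b)))"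
      unfolding R by (simp add: sum_distrib_left ac_simps)
    also have "\<dots> = (\<Sum>a\<in>UNIV. \<Sum>k\<in>UNIV. \<Sum>b\<in>UNIV. c * (?e a b * (?h $ k $ i * U k a b)))"
      by (rule sum.swap)
    also have "\<dots> = (\<Sum>a\<in>UNIV. \<Sum>b\<in>UNIV. \<Sum>k\<in>UNIV. c * (?e a b * (?h $ k $ i * U k a b)))"
      by (intro sum.cong refl sum.swap)
    also have "\<dots> = c * (\<Sum>a\<in>UNIV. \<Sum>b\<in>UNIV. ?e a b * V i a b)"
      unfolding V_def by (simp add: sum_distrib_left)
    finally show "(\<Sum>k\<in>UNIV. ?h $ k $ i * ?R i j k) = c * (\<Sum>a\<in>UNIV. \<Sum>b\<in>UNIV. ?e a b * V i a b)" .
  qed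
  also have "\<dots> = 0"
  proof -
    define T where "T i = (\<Sum>a\<in>UNIV. \<Sum>b\<in>UNIV.
      coord_vol (axis i 1) (axis j 1) (axis a 1) (axis b 1) * V i a b)" for i
    have "j = 1 \<or> j = 2 \<or> j = 3 \<or> j = 4" by (rule exhaust_4)
    \<comment> \<open>For fixed j the term T j vanishes, and the other three are, up to one common
      sign, twice the cyclic sum of \<open>V\<close> over the indices other than j.\<close>
    then have "T 1 + T 2 + T 3 + T 4 = 0"
      using V_cyclic[of 2 3 4] V_cyclic[of 1 3 4] V_cyclic[of 1 2 4] V_cyclic[of 1 2 3]
      unfolding T_def
      by (elim disjE; simp only: levi_civita_sum V_antisym[of _ 4 3] V_antisym[of _ 4 2]
          V_antisym[of _ 4 1] V_antisym[of _ 3 2] V_antisym[of _ 3 1] V_antisym[of _ 2 1]; linarith)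
    then show ?thesis
      unfolding T_def[symmetric] sum_distrib_left[symmetric] sum_4[of T] by simp
  qed
  finally show ?thesis .
qed

end

section \<open>A metric given by a null tetrad\<close>

text \<open>The vector fields have the components $W = (1,0,A,B)$, $\tilde W = (1,0,0,0)$,
  $Z = (0,1,P,Q)$ and $\tilde Z = (0,0,0,-m)$, where $A, B, P, Q, m$ are treated as independent
  numbers; \<open>coef_A\<close>, ..., \<open>coef_Q\<close> below are their values for a KdV potential.\<close>

definition tetrad :: "real \<Rightarrow> real \<Rightarrow> real \<Rightarrow> real \<Rightarrow> real \<Rightarrow> real ^ 4 ^ 4" where
  "tetrad m A B P Q = vector [vector [1, 0, A, B], vector [1, 0, 0, 0],
     vector [0, 1, P, Q], vector [0, 0, 0, - m]]"

definition cotetrad :: "real \<Rightarrow> real \<Rightarrow> real \<Rightarrow> real \<Rightarrow> real \<Rightarrow> real ^ 4 ^ 4" where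
  "cotetrad m A B P Q = vector [vector [0, - P / A, 1 / A, 0], vector [1, P / A, - 1 / A, 0],
     vector [0, 1, 0, 0], vector [0, Q / m - B * P / (m * A), B / (m * A), - 1 / m]]"

definition tetrad_metric :: "real \<Rightarrow> real \<Rightarrow> real \<Rightarrow> real \<Rightarrow> real \<Rightarrow> real ^ 4 ^ 4" where
  "tetrad_metric m A B P Q = vector [
     vector [0, m * P, - m, 0],
     vector [m * P, 2 * m * P\<^sup>2 / A - 2 * B * P + 2 * A * Q, B - 2 * m * P / A, - A],
     vector [- m, B - 2 * m * P / A, 2 * m / A, 0],
     vector [0, - A, 0, 0]]"

definition tetrad_metric_inv :: "real \<Rightarrow> real \<Rightarrow> real \<Rightarrow> real \<Rightarrow> real \<Rightarrow> real ^ 4 ^ 4" where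
  "tetrad_metric_inv m A B P Q = vector [
     vector [- 2 / (m * A), 0, - 1 / m, - B / (m * A)],
     vector [0, 0, 0, - 1 / A],
     vector [- 1 / m, 0, 0, - P / A],
     vector [- B / (m * A), - 1 / A, - P / A, - 2 * Q / A]]"

text \<open>Duality is the matrix equation \<open>E ** transpose X = mat 1\<close>, so the
  uniqueness demanded by the definite description is uniqueness of an inverse matrix.\<close>

lemma dual_coframe_tetrad:
  assumes "m \<noteq> 0" "A \<noteq> 0"
  shows "dual_coframe (tetrad m A B P Q) = cotetrad m A B P Q"
proof -
  let ?X = "tetrad m A B P Q" and ?E = "cotetrad m A B P Q"
  have eq: "(\<forall>a b. (E $ a) \<bullet> (?X $ b) = (if a = b then 1 else 0)) \<longleftrightarrow> E ** transpose ?X = mat 1" for E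
    unfolding vec_eq_iff matrix_matrix_mult_def transpose_def mat_def inner_vec_def by simp
  have "?E ** transpose ?X = mat 1"
    unfolding eq[symmetric]
    unfolding forall_4 inner_vec_def sum_4 tetrad_def cotetrad_def
    using assms by (simp add: field_simps)
  moreover have "E = ?E" if "E ** transpose ?X = mat 1" for E
  proof -
    have "transpose ?X ** ?E = mat 1"
      using calculation matrix_left_right_inverse by blast
    then have "E = E ** (transpose ?X ** ?E)" by simp
    also have "\<dots> = ?E" unfolding matrix_mul_assoc that by simp
    finally show ?thesis .
  qed
  ultimately show ?thesis
    unfolding dual_coframe_def eq by (rule the_equality)
qed

lemma tetrad_metric_cotetrad:
  fixes m A B P Q :: real
  defines "e \<equiv> cotetrad m A B P Q"
  assumes "m \<noteq> 0" "A \<noteq> 0"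
  shows "tetrad_metric m A B P Q = (- (m * A)) *\<^sub>R (sym_prod (e $ 1) (e $ 2) - sym_prod (e $ 3) (e $ 4))"
  unfolding vec_eq_iff forall_4 e_def tetrad_metric_def cotetrad_def sym_prod_def
  using assms(2,3) by (simp add: field_simps power2_eq_square)

lemma tetrad_metric_inverse:
  assumes "m \<noteq> 0" "A \<noteq> 0"
  shows "tetrad_metric m A B P Q ** tetrad_metric_inv m A B P Q = mat 1"
  unfolding vec_eq_iff forall_4 tetrad_metric_def tetrad_metric_inv_def matrix_matrix_mult_def sum_4 mat_def
  using assms by (simp add: field_simps power2_eq_square)

text \<open>A perfect square: the density in the volume form is the absolute value of m A, with no
  root left over.\<close>

lemma det_tetrad_metric: "det (tetrad_metric m A B P Q) = (m * A)\<^sup>2"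
  unfolding det_4 tetrad_metric_def by (simp add: power2_eq_square)

lemma transpose_tetrad_metric: "transpose (tetrad_metric m A B P Q) = tetrad_metric m A B P Q"
  unfolding vec_eq_iff forall_4 transpose_def tetrad_metric_def by simp

lemma tetrad_metric_apply:
  fixes m A B P Q :: real
  defines "h \<equiv> tensor2_apply (tetrad_metric m A B P Q)" and "X \<equiv> tetrad m A B P Q"
  assumes "m \<noteq> 0" "A \<noteq> 0"
  shows "h (X $ 1) (X $ 2) = - (m * A)" "h (X $ 3) (X $ 4) = m * A"
    "h (X $ 1) (X $ 1) = 0" "h (X $ 2) (X $ 2) = 0" "h (X $ 3) (X $ 3) = 0" "h (X $ 4) (X $ 4) = 0"
    "h (X $ 1) (X $ 3) = 0" "h (X $ 1) (X $ 4) = 0" "h (X $ 2) (X $ 3) = 0" "h (X $ 2) (X $ 4) = 0"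
  unfolding h_def X_def tensor2_apply_def tetrad_def tetrad_metric_def sum_4
  using assms(3,4) by (simp_all add: field_simps power2_eq_square)

lemma tensor2_apply_sym: "transpose G = G \<Longrightarrow> tensor2_apply G u v = tensor2_apply G v u"
  unfolding tensor2_apply_def vec_eq_iff transpose_def
  by (subst sum.swap) (simp add: mult.assoc mult.commute[of "u $ _"])

lemma tensor2_apply_add_scaleR:
  "tensor2_apply G (u + a *\<^sub>R u') (v + b *\<^sub>R v') = tensor2_apply G u v + b * tensor2_apply G u v'
     + a * tensor2_apply G u' v + a * b * tensor2_apply G u' v'"
  unfolding tensor2_apply_def
  by (simp add: sum.distrib sum_distrib_left algebra_simps)

lemma ultrahyperbolic_tetrad_metric:
  assumes "m \<noteq> 0" "A \<noteq> 0"
  shows "ultrahyperbolic (tetrad_metric m A B P Q)"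
proof -
  let ?G = "tetrad_metric m A B P Q" and ?X = "tetrad m A B P Q"
  \<comment> \<open>Adding a multiple t of its partner to a null vector gives square norm 2 t times
    their product. The products are - m A and m A, so t = 1/(2 m A) and its negative give norms 1
    and -1. As d = - c, the two combinations from one null pair are orthogonal. No case split on the
    sign of m A arises.\<close>
  define c d where "c = 1 / (2 * m * A)" and "d = - 1 / (2 * m * A)"
  define v where "v = (\<lambda>a :: 4. if a = 1 then ?X $ 1 + d *\<^sub>R ?X $ 2
    else if a = 2 then ?X $ 3 + c *\<^sub>R ?X $ 4
    else if a = 3 then ?X $ 1 + c *\<^sub>R ?X $ 2 else ?X $ 3 + d *\<^sub>R ?X $ 4)"
  note s = tensor2_apply_sym[OF transpose_tetrad_metric, of m A B P Q]
  have cd: "c * (m * A) = 1 / 2" "d * (m * A) = - 1 / 2"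
    using assms by (simp_all add: c_def d_def)
  have "tensor2_apply ?G (v a) (v b) =
      (if a \<noteq> b then 0 else if a = 1 \<or> a = 2 then 1 else - 1)" for a b
    using exhaust_4[of a] exhaust_4[of b]
    by (elim disjE; simp add: v_def tensor2_apply_add_scaleR tetrad_metric_apply[OF assms]
        s[of "?X $ 2" "?X $ 1"] s[of "?X $ 3" "?X $ 1"] s[of "?X $ 4" "?X $ 1"]
        s[of "?X $ 3" "?X $ 2"] s[of "?X $ 4" "?X $ 2"] s[of "?X $ 4" "?X $ 3"] cd)
  then show ?thesis
    unfolding ultrahyperbolic_def using transpose_tetrad_metric by blast
qed

lemma tensor2_apply_complex_scale:
  "tensor2_apply_complex G (complex_scale c u) (complex_scale c v) = c\<^sup>2 * of_real (tensor2_apply G u v)"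
  unfolding tensor2_apply_complex_def tensor2_apply_def complex_scale_def
  by (simp add: sum_distrib_left power2_eq_square ac_simps)

text \<open>Every product of two rescaled vectors carries the factor f^(-2), so only the square of f
  matters and either root, real or imaginary, will do.\<close>

lemma normalised_null_tetrad_tetrad:
  fixes f :: complex and m A B P Q :: real
  defines "X \<equiv> tetrad m A B P Q"
  assumes mA: "m \<noteq> 0" "A \<noteq> 0" and f: "f\<^sup>2 = of_real (- (m * A))"
  shows "normalised_null_tetrad (tetrad_metric m A B P Q)
    (complex_scale (inverse f) (X $ 1)) (complex_scale (inverse f) (X $ 2))
    (complex_scale (inverse f) (X $ 3)) (complex_scale (inverse f) (X $ 4))"
proof -
  have "(inverse f)\<^sup>2 * of_real (- (m * A)) = 1" "(inverse f)\<^sup>2 * of_real (m * A) = - 1"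
    using f mA by (auto simp: power_inverse field_simps simp del: of_real_mult)
  then show ?thesis
    unfolding normalised_null_tetrad_def Let_def tensor2_apply_complex_scale X_def
    by (simp add: tetrad_metric_apply[OF mA])
qed

text \<open>The condition on \<open>\<epsilon>\<close> makes it the sign of m A. It therefore
  absorbs the absolute value in the volume density, leaving the rational factor m A.\<close>

lemma hodge2_tetrad_metric:
  fixes m A B P Q :: real
  defines "h \<equiv> tetrad_metric_inv m A B P Q"
  assumes mA: "m \<noteq> 0" "A \<noteq> 0" and \<epsilon>: "\<epsilon> * \<bar>m * A\<bar> = m * A"
  shows "hodge2 (tetrad_metric m A B P Q) \<epsilon> M $ i $ j = m * A / 2 *
    (\<Sum>k\<in>UNIV. \<Sum>l\<in>UNIV. coord_vol (axis i 1) (axis j 1) (axis k 1) (axis l 1) *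
      (\<Sum>a\<in>UNIV. h $ l $ a * (\<Sum>b\<in>UNIV. h $ k $ b * M $ b $ a)))"
  unfolding hodge2_nth det_tetrad_metric matrix_inv_eqI[OF tetrad_metric_inverse[OF mA]] h_def
  using \<epsilon> by (simp add: matrix_matrix_mult_def transpose_def mult.commute)

text \<open>Self-dual forms are a three-dimensional subspace of the six-dimensional space of
  alternating matrices. The last three hypotheses are linear equations that cut it out, in the shape
  in which the curvature identities deliver them.\<close>

lemma self_dual_tetrad_metric:
  fixes M :: "real ^ 4 ^ 4"
  assumes mA: "m \<noteq> 0" "A \<noteq> 0" and \<epsilon>: "\<epsilon> * \<bar>m * A\<bar> = m * A"
    and anti: "\<And>i j. M $ i $ j = - (M $ j $ i)"
    and 14: "M $ 1 $ 4 = 0"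
    and 13: "A * M $ 1 $ 3 = m * (M $ 2 $ 4 + P * M $ 3 $ 4)"
    and 12: "M $ 1 $ 2 + P * M $ 1 $ 3 = A * M $ 2 $ 3 - A * Q * M $ 3 $ 4 + B * (M $ 2 $ 4 + P * M $ 3 $ 4)"
  shows "self_dual2 (tetrad_metric m A B P Q) \<epsilon> M"
proof -
  \<comment> \<open>Coordinates on the solutions of the three equations: all other entries of
    \<open>M\<close> are expressed through a, b, c before the star is evaluated.\<close>
  define a b c where abc: "a = M $ 2 $ 3" "b = M $ 2 $ 4 + P * M $ 3 $ 4" "c = M $ 3 $ 4"
  have diag: "M $ i $ i = 0" for i using anti[of i i] by simp
  have M13: "M $ 1 $ 3 = m * b / A" using 13 mA by (simp add: abc field_simps)
  have M: "M $ 2 $ 3 = a" "M $ 3 $ 4 = c" "M $ 2 $ 4 = b - P * c" "M $ 1 $ 4 = 0" "M $ 1 $ 3 = m * b / A"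
    "M $ 1 $ 2 = A * a - A * Q * c + B * b - P * m * b / A"
    using 12 14 M13 by (simp_all add: abc algebra_simps)
  have M': "M $ 2 $ 1 = - (M $ 1 $ 2)" "M $ 3 $ 1 = - (M $ 1 $ 3)" "M $ 4 $ 1 = - (M $ 1 $ 4)"
    "M $ 3 $ 2 = - (M $ 2 $ 3)" "M $ 4 $ 2 = - (M $ 2 $ 4)" "M $ 4 $ 3 = - (M $ 3 $ 4)"
    by (rule anti)+
  show ?thesis
    unfolding self_dual2_def vec_eq_iff forall_4 hodge2_tetrad_metric[OF mA \<epsilon>] levi_civita_sum
    unfolding sum_4 tetrad_metric_inv_def M' M diag vector_4
    using mA by (simp add: field_simps power2_eq_square)
qed

lemma anti_self_dual_tetrad_metric:
  fixes m A B P Q :: real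
  defines "e \<equiv> cotetrad m A B P Q"
  assumes mA: "m \<noteq> 0" "A \<noteq> 0" and \<epsilon>: "\<epsilon> * \<bar>m * A\<bar> = m * A"
    and F: "F \<in> {(- (m * A)) *\<^sub>R wedge (e $ 1) (e $ 3),
         (- (m * A)) *\<^sub>R (wedge (e $ 1) (e $ 2) - wedge (e $ 3) (e $ 4)),
         (- (m * A)) *\<^sub>R wedge (e $ 2) (e $ 4)}"
  shows "anti_self_dual2 (tetrad_metric m A B P Q) \<epsilon> F"
proof -
  note defs = anti_self_dual2_def vec_eq_iff forall_4 hodge2_tetrad_metric[OF mA \<epsilon>] levi_civita_sum
  note expand = sum_4 tetrad_metric_inv_def vector_4 e_def wedge_def cotetrad_def
  have "anti_self_dual2 (tetrad_metric m A B P Q) \<epsilon> ((- (m * A)) *\<^sub>R wedge (e $ 1) (e $ 3))"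
    unfolding defs unfolding expand using mA by (simp add: field_simps power2_eq_square)
  moreover have "anti_self_dual2 (tetrad_metric m A B P Q) \<epsilon>
      ((- (m * A)) *\<^sub>R (wedge (e $ 1) (e $ 2) - wedge (e $ 3) (e $ 4)))"
    unfolding defs unfolding expand using mA by (simp add: field_simps power2_eq_square)
  moreover have "anti_self_dual2 (tetrad_metric m A B P Q) \<epsilon> ((- (m * A)) *\<^sub>R wedge (e $ 2) (e $ 4))"
    unfolding defs unfolding expand using mA by (simp add: field_simps power2_eq_square)
  ultimately show ?thesis using F by blast
qed

text \<open>Reversing the orientation reverses the sign of the star, so a form that is
  anti-self-dual for both orientations is zero; but the (2,3) entry of this one is m.\<close>

lemma anti_self_dual_tetrad_metric_imp_orientation:
  fixes m A B P Q :: real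
  defines "e \<equiv> cotetrad m A B P Q"
  assumes mA: "m \<noteq> 0" "A \<noteq> 0" and \<epsilon>: "\<epsilon> = 1 \<or> \<epsilon> = - 1"
    and asd: "anti_self_dual2 (tetrad_metric m A B P Q) \<epsilon> ((- (m * A)) *\<^sub>R wedge (e $ 1) (e $ 3))"
  shows "\<epsilon> * \<bar>m * A\<bar> = m * A"
proof (rule ccontr)
  assume neg: "\<epsilon> * \<bar>m * A\<bar> \<noteq> m * A"
  let ?G = "tetrad_metric m A B P Q" and ?F = "(- (m * A)) *\<^sub>R wedge (e $ 1) (e $ 3)"
  have "(- \<epsilon>) * \<bar>m * A\<bar> = m * A" using \<epsilon> neg by (auto simp: abs_if split: if_splits)
  then have "anti_self_dual2 ?G (- \<epsilon>) ?F"
    unfolding e_def by (intro anti_self_dual_tetrad_metric mA) auto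
  then have "hodge2 ?G (- \<epsilon>) ?F $ 2 $ 3 = - (?F $ 2 $ 3)" "hodge2 ?G \<epsilon> ?F $ 2 $ 3 = - (?F $ 2 $ 3)"
    using asd unfolding anti_self_dual2_def by simp_all
  moreover have "hodge2 ?G (- \<epsilon>) ?F $ 2 $ 3 = - (hodge2 ?G \<epsilon> ?F $ 2 $ 3)"
    unfolding hodge2_nth by simp
  ultimately have "?F $ 2 $ 3 = 0" by simp
  then show False using mA by (simp add: e_def wedge_def cotetrad_def)
qed

section \<open>Fields of null tetrads\<close>

locale null_tetrad =
  fixes S :: "(real ^ 4) set" and g :: "real ^ 4 \<Rightarrow> real ^ 4 ^ 4" and A B P Q :: "real ^ 4 \<Rightarrow> real"
  assumes open_S: "open S"
    and smooth: "smooth_on S A" "smooth_on S B" "smooth_on S P" "smooth_on S Q"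
    and m_nz: "p \<in> S \<Longrightarrow> p $ 3 \<noteq> 0"
    and A_nz: "p \<in> S \<Longrightarrow> A p \<noteq> 0"
    and g_eq: "p \<in> S \<Longrightarrow> g p = tetrad_metric (p $ 3) (A p) (B p) (P p) (Q p)"
begin

lemma smooth_entries:
  "smooth_on S (\<lambda>p. tetrad_metric (p $ 3) (A p) (B p) (P p) (Q p) $ i $ j)"
  "smooth_on S (\<lambda>p. tetrad_metric_inv (p $ 3) (A p) (B p) (P p) (Q p) $ i $ j)"
  using exhaust_4[of i] exhaust_4[of j] m_nz A_nz
  by (elim disjE; simp add: tetrad_metric_def tetrad_metric_inv_def;
      intro smooth_on_intros open_S smooth; simp)+

lemma matrix_inv_g: "p \<in> S \<Longrightarrow> matrix_inv (g p) = tetrad_metric_inv (p $ 3) (A p) (B p) (P p) (Q p)"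
  unfolding g_eq by (intro matrix_inv_eqI tetrad_metric_inverse m_nz A_nz)

sublocale smooth_metric S g
proof
  show "open S" by (rule open_S)
  show "smooth_on S (\<lambda>p. g p $ i $ j)" for i j
    by (rule smooth_on_cong[OF open_S smooth_entries(1)]) (simp add: g_eq)
  show "smooth_on S (\<lambda>p. matrix_inv (g p) $ i $ j)" for i j
    by (rule smooth_on_cong[OF open_S smooth_entries(2)]) (simp add: matrix_inv_g)
  show "g p $ i $ j = g p $ j $ i" if "p \<in> S" for p i j
  proof -
    have "transpose (g p) $ i $ j = g p $ i $ j"
      using transpose_tetrad_metric by (simp add: g_eq[OF that])
    then show ?thesis by (simp add: transpose_def)
  qed
  show "matrix_inv (g p) ** g p = mat 1" if "p \<in> S" for p
    unfolding matrix_inv_g[OF that] unfolding g_eq[OF that]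
    using tetrad_metric_inverse[OF m_nz[OF that] A_nz[OF that]] matrix_left_right_inverse by blast
qed

lemma has_partials:
  assumes "p \<in> S"
  shows "has_partial k A (partial k A p) p" "has_partial k B (partial k B p) p"
    "has_partial k P (partial k P p) p" "has_partial k Q (partial k Q p) p"
  using smooth_on_has_partial[OF open_S _ assms] smooth by blast+

text \<open>\<open>\<delta>\<close> is the k-th derivative of the coordinate m, which lets one table
  serve all four directions.\<close>

lemma partial_g:
  fixes k :: 4
  assumes p: "p \<in> S"
  defines "D \<equiv> \<lambda>i j. partial k (\<lambda>p. g p $ i $ j) p" and "\<delta> \<equiv> if k = 3 then 1 else 0"
  shows "D 1 1 = 0" "D 1 2 = \<delta> * P p + p $ 3 * partial k P p" "D 1 3 = - \<delta>" "D 1 4 = 0"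
    "D 2 1 = \<delta> * P p + p $ 3 * partial k P p"
    "D 2 2 = 2 * (\<delta> * (P p)\<^sup>2 + 2 * p $ 3 * P p * partial k P p) / A p
       - 2 * p $ 3 * (P p)\<^sup>2 * partial k A p / (A p)\<^sup>2
       - 2 * (partial k B p * P p + B p * partial k P p) + 2 * (partial k A p * Q p + A p * partial k Q p)"
    "D 2 3 = partial k B p - 2 * (\<delta> * P p + p $ 3 * partial k P p) / A p
       + 2 * p $ 3 * P p * partial k A p / (A p)\<^sup>2"
    "D 2 4 = - partial k A p"
    "D 3 1 = - \<delta>"
    "D 3 2 = partial k B p - 2 * (\<delta> * P p + p $ 3 * partial k P p) / A p
       + 2 * p $ 3 * P p * partial k A p / (A p)\<^sup>2"
    "D 3 3 = 2 * \<delta> / A p - 2 * p $ 3 * partial k A p / (A p)\<^sup>2" "D 3 4 = 0"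
    "D 4 1 = 0" "D 4 2 = - partial k A p" "D 4 3 = 0" "D 4 4 = 0"
proof -
  let ?G = "\<lambda>p. tetrad_metric (p $ 3) (A p) (B p) (P p) (Q p)"
  have D: "D i j = E" if "has_partial k (\<lambda>p. ?G p $ i $ j) E p" for i j E
    unfolding D_def using has_partial_imp_partial[OF that]
      partial_cong_on[OF open_S p, of "\<lambda>p. g p $ i $ j" "\<lambda>p. ?G p $ i $ j" k] g_eq by simp
  note rules = has_partial_const has_partial_coord has_partial_add has_partial_diff has_partial_minus
    has_partial_mult has_partial_divide has_partial_power2 has_partials[OF p] A_nz[OF p]
  note [simp] = tetrad_metric_def
  show "D 1 1 = 0" "D 1 4 = 0" "D 3 4 = 0" "D 4 1 = 0" "D 4 3 = 0" "D 4 4 = 0"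
    by (rule D, simp, rule rules)+
  show "D 1 2 = \<delta> * P p + p $ 3 * partial k P p" "D 2 1 = \<delta> * P p + p $ 3 * partial k P p"
    by (rule D, simp only: tetrad_metric_def vector_4, rule has_partial_eq_rhs, (rule rules)+, simp add: \<delta>_def)+
  show "D 1 3 = - \<delta>" "D 3 1 = - \<delta>"
    by (rule D, simp only: tetrad_metric_def vector_4, rule has_partial_eq_rhs, (rule rules)+, simp add: \<delta>_def)+
  show "D 2 4 = - partial k A p" "D 4 2 = - partial k A p"
    by (rule D, simp only: tetrad_metric_def vector_4, rule has_partial_eq_rhs, (rule rules)+, simp)+
  show "D 2 2 = 2 * (\<delta> * (P p)\<^sup>2 + 2 * p $ 3 * P p * partial k P p) / A p
       - 2 * p $ 3 * (P p)\<^sup>2 * partial k A p / (A p)\<^sup>2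
       - 2 * (partial k B p * P p + B p * partial k P p) + 2 * (partial k A p * Q p + A p * partial k Q p)"
    by (rule D, simp only: tetrad_metric_def vector_4, rule has_partial_eq_rhs, (rule rules)+)
      (use A_nz[OF p] in \<open>simp add: \<delta>_def field_simps power2_eq_square\<close>)
  show "D 2 3 = partial k B p - 2 * (\<delta> * P p + p $ 3 * partial k P p) / A p
       + 2 * p $ 3 * P p * partial k A p / (A p)\<^sup>2"
    "D 3 2 = partial k B p - 2 * (\<delta> * P p + p $ 3 * partial k P p) / A p
       + 2 * p $ 3 * P p * partial k A p / (A p)\<^sup>2"
    by (rule D, simp only: tetrad_metric_def vector_4, rule has_partial_eq_rhs, (rule rules)+,
        use A_nz[OF p] in \<open>simp add: \<delta>_def field_simps power2_eq_square\<close>)+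
  show "D 3 3 = 2 * \<delta> / A p - 2 * p $ 3 * partial k A p / (A p)\<^sup>2"
    by (rule D, simp only: tetrad_metric_def vector_4, rule has_partial_eq_rhs, (rule rules)+)
      (use A_nz[OF p] in \<open>simp add: \<delta>_def field_simps power2_eq_square\<close>)
qed

text \<open>Twice the Christoffel symbol of the first kind. Kept as a constant, it allows the
  vanishing symbols to be removed before any metric entry is expanded.\<close>

definition koszul :: "4 \<Rightarrow> 4 \<Rightarrow> 4 \<Rightarrow> real ^ 4 \<Rightarrow> real" where
  "koszul l j k p = partial j (\<lambda>p. g p $ l $ k) p + partial k (\<lambda>p. g p $ l $ j) p
     - partial l (\<lambda>p. g p $ j $ k) p"

lemma christoffel_koszul:
  assumes p: "p \<in> S"
  shows "christoffel g 1 j k p = - koszul 1 j k p / (p $ 3 * A p) - koszul 3 j k p / (2 * p $ 3)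
           - B p * koszul 4 j k p / (2 * p $ 3 * A p)"
    "christoffel g 2 j k p = - koszul 4 j k p / (2 * A p)"
    "christoffel g 3 j k p = - koszul 1 j k p / (2 * p $ 3) - P p * koszul 4 j k p / (2 * A p)"
    "christoffel g 4 j k p = - B p * koszul 1 j k p / (2 * p $ 3 * A p) - koszul 2 j k p / (2 * A p)
           - P p * koszul 3 j k p / (2 * A p) - Q p * koszul 4 j k p / A p"
  unfolding christoffel_def koszul_def[symmetric] matrix_inv_g[OF p] tetrad_metric_inv_def sum_4 vector_4
  using m_nz[OF p] A_nz[OF p] by (simp_all add: field_simps)

end

text \<open>The relations say that the anti-self-dual two-forms
  $\Sigma_2 = -m\,dm\wedge dx + mP\,dz\wedge dx + B\,dz\wedge dm - A\,dz\wedge dn$ and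
  $\Sigma_3 = -B\,dx\wedge dm - (AQ-BP)\,dx\wedge dz + A\,dx\wedge dn + Q\,dm\wedge dz - dm\wedge dn
  + P\,dz\wedge dn$ are closed; $\Sigma_1 = -m\,dm\wedge dz$ is closed anyway.\<close>

locale closed_null_tetrad = null_tetrad +
  assumes closed: "p \<in> S \<Longrightarrow> partial 1 A p = - (p $ 3 * partial 4 P p)"
    "p \<in> S \<Longrightarrow> partial 1 B p = P p + p $ 3 * partial 3 P p"
    "p \<in> S \<Longrightarrow> partial 4 B p = - partial 3 A p"
    "p \<in> S \<Longrightarrow> partial 4 Q p = - partial 3 P p"
    "p \<in> S \<Longrightarrow> partial 1 Q p = partial 2 B p
       - (partial 3 A p * Q p + A p * partial 3 Q p - partial 3 B p * P p - B p * partial 3 P p)"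
    "p \<in> S \<Longrightarrow> partial 1 P p = partial 2 A p
       + (partial 4 A p * Q p - A p * partial 3 P p + partial 3 A p * P p - B p * partial 4 P p)"
begin

section \<open>Connection and parallel two-forms of a closed null tetrad\<close>

definition \<Sigma>1 :: "real ^ 4 \<Rightarrow> real ^ 4 ^ 4" where
  "\<Sigma>1 p = vector [vector [0, 0, 0, 0], vector [0, 0, p $ 3, 0], vector [0, - (p $ 3), 0, 0], vector [0, 0, 0, 0]]"

text \<open>In terms of the tetrad this is f^2 (e_W \<and> e_W' - e_Z \<and> e_Z') with f^2 = - m A,
  multiplied out in coordinates; here \<and> is the wedge product.\<close>

definition \<Sigma>2 :: "real ^ 4 \<Rightarrow> real ^ 4 ^ 4" where
  "\<Sigma>2 p = vector [vector [0, - (p $ 3 * P p), p $ 3, 0], vector [p $ 3 * P p, 0, B p, - A p],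
     vector [- (p $ 3), - B p, 0, 0], vector [0, A p, 0, 0]]"

text \<open>Directions 1 and 4 span the totally null plane of the tilde fields, the kernel of
  \<open>\<Sigma>1\<close>. These vanishings make that plane distribution parallel. Most are
  automatic because the metric entries involved are constant or equal up to sign; the pairings with
  direction 2 use the first closedness relation.\<close>

lemma koszul_zero:
  assumes p: "p \<in> S"
  shows "koszul 1 1 j p = 0" "koszul 1 j 1 p = 0" "koszul 1 4 j p = 0" "koszul 1 j 4 p = 0"
    "koszul 4 1 j p = 0" "koszul 4 j 1 p = 0" "koszul 4 4 j p = 0" "koszul 4 j 4 p = 0"
    "koszul 3 1 1 p = 0" "koszul 3 1 4 p = 0" "koszul 3 4 1 p = 0" "koszul 3 4 4 p = 0"
  using exhaust_4[of j]
  by (auto simp: koszul_def partial_g[OF p] closed[OF p])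

text \<open>Both sides of the equation for a parallel form alternate in i and j, so the six
  components with i < j decide it.\<close>

lemma parallelI_alternating:
  assumes anti: "\<And>i j p. F i j p = - F j i p"
    and F: "\<And>p k i j. p \<in> S \<Longrightarrow> (i, j) \<in> {(1,2),(1,3),(1,4),(2,3),(2,4),(3,4)} \<Longrightarrow>
      has_partial k (F i j)
        (\<Sum>s\<in>UNIV. christoffel g s k i p * F s j p + christoffel g s k j p * F i s p) p"
  shows "parallel F"
proof -
  let ?R = "\<lambda>p k i j. \<Sum>s\<in>UNIV. christoffel g s k i p * F s j p + christoffel g s k j p * F i s p"
  have R_anti: "?R p k j i = - ?R p k i j" for p k i j
    unfolding sum_negf[symmetric] by (rule sum.cong[OF refl]) (simp add: anti[of _ i] anti[of _ j])
  have "has_partial k (F i j) (?R p k i j) p" if p: "p \<in> S" for p k i j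
  proof -
    consider "i = j" | "(i, j) \<in> {(1,2),(1,3),(1,4),(2,3),(2,4),(3,4)}"
      | "(j, i) \<in> {(1,2),(1,3),(1,4),(2,3),(2,4),(3,4)}"
      using exhaust_4[of i] exhaust_4[of j] by auto
    then show ?thesis
    proof cases
      case 1
      have "F j j = (\<lambda>p. 0)" "?R p k j j = 0"
        using anti[of j j] R_anti[where p=p and k=k and i=j and j=j] by (simp_all add: fun_eq_iff)
      then show ?thesis using 1 has_partial_const[of k 0 p] by simp
    next
      case 2
      then show ?thesis by (rule F[OF p])
    next
      case 3
      have "F i j = (\<lambda>p. - F j i p)" using anti by blast
      then show ?thesis using has_partial_minus[OF F[OF p 3, where k=k]] R_anti[where p=p and k=k and i=i and j=j] by simp
    qed
  qed
  then show ?thesis unfolding parallel_def using has_partial_imp_partial by blast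
qed

lemma koszul_values:
  assumes p: "p \<in> S"
  shows "koszul 1 2 3 p = 2 * p $ 3 * partial 1 P p / A p + 2 * (p $ 3)\<^sup>2 * P p * partial 4 P p / (A p)\<^sup>2"
    "koszul 1 3 3 p = - 2 - 2 * (p $ 3)\<^sup>2 * partial 4 P p / (A p)\<^sup>2"
    "koszul 4 2 2 p = - 2 * partial 2 A p - 4 * p $ 3 * P p * partial 4 P p / A p
       + 2 * p $ 3 * (P p)\<^sup>2 * partial 4 A p / (A p)\<^sup>2
       + 2 * (B p * partial 4 P p - partial 3 A p * P p) - 2 * (partial 4 A p * Q p - A p * partial 3 P p)"
    "koszul 4 2 3 p = 2 * p $ 3 * partial 4 P p / A p - 2 * p $ 3 * P p * partial 4 A p / (A p)\<^sup>2"
    "koszul 4 3 3 p = 2 * p $ 3 * partial 4 A p / (A p)\<^sup>2"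
  by (simp_all add: koszul_def partial_g[OF p] closed(1-4)[OF p] power2_eq_square algebra_simps)

lemma koszul_sym: "p \<in> S \<Longrightarrow> koszul l j k p = koszul l k j p"
  unfolding koszul_def by (simp add: partial_g_sym[of p l j k])


text \<open>The (2,3) component of the equation for \<open>\<Sigma>1\<close>: the connection induced
  on the quotient by the null plane preserves the area form m dz \<and> dm. The sixth closedness
  relation is needed to trade the x-derivative of P for the z-derivative of A.\<close>

lemma connection_\<Sigma>1:
  assumes p: "p \<in> S"
  shows "p $ 3 * (christoffel g 2 k 2 p + christoffel g 3 k 3 p) = (if k = 3 then 1 else 0)"
  using exhaust_4[of k] m_nz[OF p] A_nz[OF p]
  by (elim disjE; simp add: christoffel_koszul[OF p] koszul_zero[OF p] koszul_sym[OF p, of _ 3 2] koszul_values[OF p];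
      simp add: closed(6)[OF p] field_simps power2_eq_square)

text \<open>This and the next four lemmas are components of the equation for
  \<open>\<Sigma>2\<close>, written without the terms removed by \<open>christoffel_zero\<close>. In
  component (1,4) every term is of that kind, so it has no lemma of its own.\<close>

lemma connection_\<Sigma>2_12:
  fixes k :: 4
  assumes p: "p \<in> S"
  defines "\<delta> \<equiv> if k = 3 then 1 else 0"
  shows "- (\<delta> * P p + p $ 3 * partial k P p) = - (p $ 3 * P p) * christoffel g 1 k 1 p + A p * christoffel g 4 k 1 p - p $ 3 * P p * christoffel g 2 k 2 p + p $ 3 * christoffel g 3 k 2 p"
  using exhaust_4[of k] m_nz[OF p] A_nz[OF p]
  by (elim disjE; simp add: \<delta>_def christoffel_koszul[OF p] koszul_zero[OF p];
      (simp add: koszul_def partial_g[OF p] closed[OF p])?;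
      simp add: field_simps power2_eq_square)

lemma connection_\<Sigma>2_13:
  fixes k :: 4
  assumes p: "p \<in> S"
  defines "\<delta> \<equiv> if k = 3 then 1 else 0"
  shows "\<delta> = p $ 3 * christoffel g 1 k 1 p - p $ 3 * P p * christoffel g 2 k 3 p + p $ 3 * christoffel g 3 k 3 p"
  using exhaust_4[of k] m_nz[OF p] A_nz[OF p]
  by (elim disjE; simp add: \<delta>_def christoffel_koszul[OF p] koszul_zero[OF p];
      (simp add: koszul_def partial_g[OF p] closed[OF p])?;
      simp add: field_simps power2_eq_square)

lemma connection_\<Sigma>2_23:
  fixes k :: 4
  assumes p: "p \<in> S"
  defines "\<delta> \<equiv> if k = 3 then 1 else 0"
  shows "partial k B p = p $ 3 * christoffel g 1 k 2 p + B p * christoffel g 2 k 2 p + p $ 3 * P p * christoffel g 1 k 3 p + B p * christoffel g 3 k 3 p - A p * christoffel g 4 k 3 p"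
  using exhaust_4[of k] m_nz[OF p] A_nz[OF p]
  by (elim disjE; simp add: \<delta>_def christoffel_koszul[OF p] koszul_zero[OF p];
      (simp add: koszul_def partial_g[OF p] closed[OF p])?;
      simp add: field_simps power2_eq_square)

lemma connection_\<Sigma>2_24:
  fixes k :: 4
  assumes p: "p \<in> S"
  defines "\<delta> \<equiv> if k = 3 then 1 else 0"
  shows "- partial k A p = - A p * christoffel g 2 k 2 p + p $ 3 * P p * christoffel g 1 k 4 p - A p * christoffel g 4 k 4 p"
  using exhaust_4[of k] m_nz[OF p] A_nz[OF p]
  by (elim disjE; simp add: \<delta>_def christoffel_koszul[OF p] koszul_zero[OF p];
      (simp add: koszul_def partial_g[OF p] closed[OF p])?;
      simp add: field_simps power2_eq_square)

lemma connection_\<Sigma>2_34: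
  fixes k :: 4
  assumes p: "p \<in> S"
  defines "\<delta> \<equiv> if k = 3 then 1 else 0"
  shows "0 = - A p * christoffel g 2 k 3 p - p $ 3 * christoffel g 1 k 4 p"
  using exhaust_4[of k] m_nz[OF p] A_nz[OF p]
  by (elim disjE; simp add: \<delta>_def christoffel_koszul[OF p] koszul_zero[OF p];
      (simp add: koszul_def partial_g[OF p] closed[OF p])?;
      simp add: field_simps power2_eq_square)

lemma christoffel_zero:
  assumes p: "p \<in> S"
  shows "christoffel g 2 k 1 p = 0" "christoffel g 3 k 1 p = 0"
    "christoffel g 2 k 4 p = 0" "christoffel g 3 k 4 p = 0"
  by (simp_all add: christoffel_koszul[OF p] koszul_zero[OF p])

text \<open>As \<open>\<Sigma>1\<close> annihilates directions 1 and 4, all components other than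
  (2,3) involve only Christoffel symbols that vanish.\<close>

lemma parallel_\<Sigma>1: "parallel (\<lambda>i j p. \<Sigma>1 p $ i $ j)"
proof (rule parallelI_alternating)
  show "\<Sigma>1 p $ i $ j = - (\<Sigma>1 p $ j $ i)" for i j p
    using exhaust_4[of i] exhaust_4[of j] by (elim disjE) (simp_all add: \<Sigma>1_def)
next
  fix p :: "real ^ 4" and i j k :: 4
  assume p: "p \<in> S" and ij: "(i, j) \<in> {(1,2),(1,3),(1,4),(2,3),(2,4),(3,4::4)}"
  define \<delta> :: real where "\<delta> = (if k = 3 then 1 else 0)"
  note coord = has_partial_coord[of k 3 p, folded \<delta>_def]
  have d: "has_partial k (\<lambda>p. \<Sigma>1 p $ 1 $ 2) 0 p" "has_partial k (\<lambda>p. \<Sigma>1 p $ 1 $ 3) 0 p"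
    "has_partial k (\<lambda>p. \<Sigma>1 p $ 1 $ 4) 0 p" "has_partial k (\<lambda>p. \<Sigma>1 p $ 2 $ 4) 0 p"
    "has_partial k (\<lambda>p. \<Sigma>1 p $ 3 $ 4) 0 p"
    "has_partial k (\<lambda>p. \<Sigma>1 p $ 2 $ 3) \<delta> p"
    by (simp_all add: \<Sigma>1_def has_partial_const coord)
  show "has_partial k (\<lambda>p. \<Sigma>1 p $ i $ j) (\<Sum>s\<in>UNIV. christoffel g s k i p * \<Sigma>1 p $ s $ j
      + christoffel g s k j p * \<Sigma>1 p $ i $ s) p"
    using ij
  proof (elim insertE emptyE Pair_inject; hypsubst)
    show "has_partial k (\<lambda>p. \<Sigma>1 p $ 1 $ 2) (\<Sum>s\<in>UNIV. christoffel g s k 1 p * \<Sigma>1 p $ s $ 2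
      + christoffel g s k 2 p * \<Sigma>1 p $ 1 $ s) p"
      by (rule has_partial_eq_rhs[OF d(1)])
        (use connection_\<Sigma>1[OF p, of k, folded \<delta>_def] christoffel_zero[OF p, of k] in
          \<open>simp add: sum_4 \<Sigma>1_def\<close>)
    show "has_partial k (\<lambda>p. \<Sigma>1 p $ 1 $ 3) (\<Sum>s\<in>UNIV. christoffel g s k 1 p * \<Sigma>1 p $ s $ 3
      + christoffel g s k 3 p * \<Sigma>1 p $ 1 $ s) p"
      by (rule has_partial_eq_rhs[OF d(2)])
        (use connection_\<Sigma>1[OF p, of k, folded \<delta>_def] christoffel_zero[OF p, of k] in
          \<open>simp add: sum_4 \<Sigma>1_def\<close>)
    show "has_partial k (\<lambda>p. \<Sigma>1 p $ 1 $ 4) (\<Sum>s\<in>UNIV. christoffel g s k 1 p * \<Sigma>1 p $ s $ 4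
      + christoffel g s k 4 p * \<Sigma>1 p $ 1 $ s) p"
      by (rule has_partial_eq_rhs[OF d(3)])
        (use connection_\<Sigma>1[OF p, of k, folded \<delta>_def] christoffel_zero[OF p, of k] in
          \<open>simp add: sum_4 \<Sigma>1_def\<close>)
    show "has_partial k (\<lambda>p. \<Sigma>1 p $ 2 $ 3) (\<Sum>s\<in>UNIV. christoffel g s k 2 p * \<Sigma>1 p $ s $ 3
      + christoffel g s k 3 p * \<Sigma>1 p $ 2 $ s) p"
      by (rule has_partial_eq_rhs[OF d(6)])
        (simp add: sum_4 \<Sigma>1_def connection_\<Sigma>1[OF p, of k, folded \<delta>_def, symmetric] algebra_simps)
    show "has_partial k (\<lambda>p. \<Sigma>1 p $ 2 $ 4) (\<Sum>s\<in>UNIV. christoffel g s k 2 p * \<Sigma>1 p $ s $ 4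
      + christoffel g s k 4 p * \<Sigma>1 p $ 2 $ s) p"
      by (rule has_partial_eq_rhs[OF d(4)])
        (use connection_\<Sigma>1[OF p, of k, folded \<delta>_def] christoffel_zero[OF p, of k] in
          \<open>simp add: sum_4 \<Sigma>1_def\<close>)
    show "has_partial k (\<lambda>p. \<Sigma>1 p $ 3 $ 4) (\<Sum>s\<in>UNIV. christoffel g s k 3 p * \<Sigma>1 p $ s $ 4
      + christoffel g s k 4 p * \<Sigma>1 p $ 3 $ s) p"
      by (rule has_partial_eq_rhs[OF d(5)])
        (use connection_\<Sigma>1[OF p, of k, folded \<delta>_def] christoffel_zero[OF p, of k] in
          \<open>simp add: sum_4 \<Sigma>1_def\<close>)
  qed
qed

lemma parallel_\<Sigma>2: "parallel (\<lambda>i j p. \<Sigma>2 p $ i $ j)"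
proof (rule parallelI_alternating)
  show "\<Sigma>2 p $ i $ j = - (\<Sigma>2 p $ j $ i)" for i j p
    using exhaust_4[of i] exhaust_4[of j] by (elim disjE) (simp_all add: \<Sigma>2_def)
next
  fix p :: "real ^ 4" and i j k :: 4
  assume p: "p \<in> S" and ij: "(i, j) \<in> {(1,2),(1,3),(1,4),(2,3),(2,4),(3,4::4)}"
  define \<delta> :: real where "\<delta> = (if k = 3 then 1 else 0)"
  note coord = has_partial_coord[of k 3 p, folded \<delta>_def]
  have d: "has_partial k (\<lambda>p. \<Sigma>2 p $ 1 $ 2) (- (\<delta> * P p + p $ 3 * partial k P p)) p"
    "has_partial k (\<lambda>p. \<Sigma>2 p $ 1 $ 3) \<delta> p"
    "has_partial k (\<lambda>p. \<Sigma>2 p $ 1 $ 4) 0 p" "has_partial k (\<lambda>p. \<Sigma>2 p $ 2 $ 3) (partial k B p) p"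
    "has_partial k (\<lambda>p. \<Sigma>2 p $ 2 $ 4) (- partial k A p) p"
    "has_partial k (\<lambda>p. \<Sigma>2 p $ 3 $ 4) 0 p"
    unfolding \<Sigma>2_def vector_4
    by (intro has_partial_const coord has_partial_minus has_partial_mult has_partials[OF p])+
  show "has_partial k (\<lambda>p. \<Sigma>2 p $ i $ j) (\<Sum>s\<in>UNIV. christoffel g s k i p * \<Sigma>2 p $ s $ j
      + christoffel g s k j p * \<Sigma>2 p $ i $ s) p"
    using ij
  proof (elim insertE emptyE Pair_inject; hypsubst)
    show "has_partial k (\<lambda>p. \<Sigma>2 p $ 1 $ 2) (\<Sum>s\<in>UNIV. christoffel g s k 1 p * \<Sigma>2 p $ s $ 2
      + christoffel g s k 2 p * \<Sigma>2 p $ 1 $ s) p"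
      by (rule has_partial_eq_rhs[OF d(1)])
        (simp only: sum_4 \<Sigma>2_def vector_4,
          use connection_\<Sigma>2_12[OF p, of k, folded \<delta>_def] christoffel_zero[OF p, of k] in algebra)
    show "has_partial k (\<lambda>p. \<Sigma>2 p $ 1 $ 3) (\<Sum>s\<in>UNIV. christoffel g s k 1 p * \<Sigma>2 p $ s $ 3
      + christoffel g s k 3 p * \<Sigma>2 p $ 1 $ s) p"
      by (rule has_partial_eq_rhs[OF d(2)])
        (simp only: sum_4 \<Sigma>2_def vector_4,
          use connection_\<Sigma>2_13[OF p, of k, folded \<delta>_def] christoffel_zero[OF p, of k] in algebra)
    show "has_partial k (\<lambda>p. \<Sigma>2 p $ 1 $ 4) (\<Sum>s\<in>UNIV. christoffel g s k 1 p * \<Sigma>2 p $ s $ 4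
      + christoffel g s k 4 p * \<Sigma>2 p $ 1 $ s) p"
      by (rule has_partial_eq_rhs[OF d(3)])
        (simp add: sum_4 \<Sigma>2_def christoffel_zero[OF p])
    show "has_partial k (\<lambda>p. \<Sigma>2 p $ 2 $ 3) (\<Sum>s\<in>UNIV. christoffel g s k 2 p * \<Sigma>2 p $ s $ 3
      + christoffel g s k 3 p * \<Sigma>2 p $ 2 $ s) p"
      by (rule has_partial_eq_rhs[OF d(4)])
        (simp only: sum_4 \<Sigma>2_def vector_4,
          use connection_\<Sigma>2_23[OF p, of k] christoffel_zero[OF p, of k] in algebra)
    show "has_partial k (\<lambda>p. \<Sigma>2 p $ 2 $ 4) (\<Sum>s\<in>UNIV. christoffel g s k 2 p * \<Sigma>2 p $ s $ 4
      + christoffel g s k 4 p * \<Sigma>2 p $ 2 $ s) p"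
      by (rule has_partial_eq_rhs[OF d(5)])
        (simp only: sum_4 \<Sigma>2_def vector_4,
          use connection_\<Sigma>2_24[OF p, of k] christoffel_zero[OF p, of k] in algebra)
    show "has_partial k (\<lambda>p. \<Sigma>2 p $ 3 $ 4) (\<Sum>s\<in>UNIV. christoffel g s k 3 p * \<Sigma>2 p $ s $ 4
      + christoffel g s k 4 p * \<Sigma>2 p $ 3 $ s) p"
      by (rule has_partial_eq_rhs[OF d(6)])
        (simp only: sum_4 \<Sigma>2_def vector_4,
          use connection_\<Sigma>2_34[OF p, of k] christoffel_zero[OF p, of k] in algebra)
  qed
qed

lemma smooth_\<Sigma>: "smooth_on S (\<lambda>p. \<Sigma>1 p $ i $ j)" "smooth_on S (\<lambda>p. \<Sigma>2 p $ i $ j)"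
  using exhaust_4[of i] exhaust_4[of j]
  by (elim disjE; simp add: \<Sigma>1_def \<Sigma>2_def; intro smooth_on_intros open_S smooth)+

text \<open>The curvature operator commutes with the parallel forms, hence lies in the self-dual part of
  the Lie algebra of the orthogonal group.\<close>

lemma riemann_self_dual:
  assumes p: "p \<in> S" and \<epsilon>: "\<epsilon> * \<bar>p $ 3 * A p\<bar> = p $ 3 * A p"
  shows "self_dual2 (g p) \<epsilon> (\<chi> i j. riemann_low g i j k l p)"
proof -
  define M :: "real ^ 4 ^ 4" where "M = (\<chi> i j. riemann_low g i j k l p)"
  have anti: "M $ i $ j = - (M $ j $ i)" for i j
    unfolding M_def vec_lambda_beta by (rule riemann_low_antisym[OF p])
  have diag: "M $ i $ i = 0" for i using anti[of i i] by simp
  have R: "riemann g s j k l p = (\<Sum>i\<in>UNIV. tetrad_metric_inv (p $ 3) (A p) (B p) (P p) (Q p) $ s $ i * M $ i $ j)" for s j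
    unfolding M_def riemann_raise[OF p] matrix_inv_g[OF p] by simp
  note nz = m_nz[OF p] A_nz[OF p]
  note c1 = parallel_curvature[OF parallel_\<Sigma>1 smooth_\<Sigma>(1) p, where k=k and l=l]
    and c2 = parallel_curvature[OF parallel_\<Sigma>2 smooth_\<Sigma>(2) p, where k=k and l=l]
  note anti6 = anti[of 2 1] anti[of 3 1] anti[of 4 1] anti[of 3 2] anti[of 4 2] anti[of 4 3]
  have entries: "riemann g 2 1 k l p = M $ 1 $ 4 / A p"
    "riemann g 2 2 k l p = M $ 2 $ 4 / A p"
    "riemann g 3 3 k l p = - M $ 1 $ 3 / p $ 3 + P p * M $ 3 $ 4 / A p"
    "riemann g 1 2 k l p = - 2 * M $ 1 $ 2 / (p $ 3 * A p) + M $ 2 $ 3 / p $ 3 + B p * M $ 2 $ 4 / (p $ 3 * A p)"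
    "riemann g 1 3 k l p = - 2 * M $ 1 $ 3 / (p $ 3 * A p) + B p * M $ 3 $ 4 / (p $ 3 * A p)"
    "riemann g 4 3 k l p = - B p * M $ 1 $ 3 / (p $ 3 * A p) - M $ 2 $ 3 / A p + 2 * Q p * M $ 3 $ 4 / A p"
    unfolding R sum_4 tetrad_metric_inv_def vector_4 diag anti6 by simp_all
  \<comment> \<open>Three components of the curvature identities suffice, one for each linear
    condition of self-duality: (1,3) and (2,3) for \<open>\<Sigma>1\<close>, and (2,3) for
    \<open>\<Sigma>2\<close>.\<close>
  have "p $ 3 * riemann g 2 1 k l p = 0"
    using c1[where i=1 and j=3] unfolding sum_4 \<Sigma>1_def vector_4 by auto
  then have 14: "M $ 1 $ 4 = 0"
    unfolding entries using nz by simp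
  have "p $ 3 * (riemann g 2 2 k l p + riemann g 3 3 k l p) = 0"
    using c1[where i=2 and j=3] unfolding sum_4 \<Sigma>1_def vector_4 by (simp add: algebra_simps)
  then have "riemann g 2 2 k l p + riemann g 3 3 k l p = 0"
    using nz by simp
  then have 13: "A p * M $ 1 $ 3 = p $ 3 * (M $ 2 $ 4 + P p * M $ 3 $ 4)"
    unfolding entries using nz by (simp add: field_simps)
  have "p $ 3 * riemann g 1 2 k l p + B p * riemann g 2 2 k l p + p $ 3 * P p * riemann g 1 3 k l p
      + B p * riemann g 3 3 k l p - A p * riemann g 4 3 k l p = 0"
    using c2[where i=2 and j=3] unfolding sum_4 \<Sigma>2_def vector_4 by (simp add: algebra_simps)
  moreover have "p $ 3 * riemann g 1 2 k l p + B p * riemann g 2 2 k l p + p $ 3 * P p * riemann g 1 3 k l p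
      + B p * riemann g 3 3 k l p - A p * riemann g 4 3 k l p =
      2 * (A p * M $ 2 $ 3 - A p * Q p * M $ 3 $ 4 + B p * (M $ 2 $ 4 + P p * M $ 3 $ 4)
        - M $ 1 $ 2 - P p * M $ 1 $ 3) / A p"
    unfolding entries using nz by (simp add: field_simps)
  ultimately have 12: "M $ 1 $ 2 + P p * M $ 1 $ 3 = A p * M $ 2 $ 3 - A p * Q p * M $ 3 $ 4
      + B p * (M $ 2 $ 4 + P p * M $ 3 $ 4)" using nz by simp
  show ?thesis
    unfolding M_def[symmetric] g_eq[OF p]
    by (rule self_dual_tetrad_metric[OF nz \<epsilon> anti 14 13 12])
qed

lemma half_flat:
  assumes \<epsilon>: "\<And>p. p \<in> S \<Longrightarrow> \<epsilon> p * \<bar>p $ 3 * A p\<bar> = p $ 3 * A p"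
  shows "half_flat_on S \<epsilon> g"
  unfolding half_flat_on_def
proof (intro ballI conjI allI)
  fix p assume p: "p \<in> S"
  show ric: "ricci g i j p = 0" for i j
    by (rule self_dual_riemann_imp_ricci_flat[OF p riemann_self_dual[OF p \<epsilon>[OF p]]])
  have "weyl g i j k l p = riemann_low g i j k l p" for i j k l
    unfolding weyl_def scalar_curv_def ric by simp
  then show "self_dual2 (g p) (\<epsilon> p) (\<chi> i j. weyl g i j k l p)" for k l
    using riemann_self_dual[OF p \<epsilon>[OF p]] by simp
qed

end

section \<open>The metric of a KdV potential\<close>

definition coef_A :: "(real ^ 2 \<Rightarrow> real) \<Rightarrow> real ^ 4 \<Rightarrow> real" where
  "coef_A q p = q (xz p) * p $ 3 + p $ 4"

definition coef_B :: "(real ^ 2 \<Rightarrow> real) \<Rightarrow> real ^ 4 \<Rightarrow> real" where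
  "coef_B q p = kdv_b q (xz p) * p $ 3 - q (xz p) * p $ 4"

definition coef_P :: "(real ^ 2 \<Rightarrow> real) \<Rightarrow> real ^ 4 \<Rightarrow> real" where
  "coef_P q p = partial 1 (kdv_b q) (xz p) / 2 * p $ 3 - partial 1 q (xz p) * p $ 4"

definition coef_Q :: "(real ^ 2 \<Rightarrow> real) \<Rightarrow> real ^ 4 \<Rightarrow> real" where
  "coef_Q q p = kdv_w q (xz p) * p $ 3 - partial 1 (kdv_b q) (xz p) / 2 * p $ 4"

abbreviation kdv_tetrad :: "(real ^ 2 \<Rightarrow> real) \<Rightarrow> real ^ 4 \<Rightarrow> real ^ 4 ^ 4" where
  "kdv_tetrad q p \<equiv> tetrad (p $ 3) (coef_A q p) (coef_B q p) (coef_P q p) (coef_Q q p)"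

lemma vf_eq_tetrad:
  "vf_W q p = kdv_tetrad q p $ 1" "vf_W' p = kdv_tetrad q p $ 2"
  "vf_Z q p = kdv_tetrad q p $ 3" "vf_Z' p = kdv_tetrad q p $ 4"
  unfolding tetrad_def vf_W_def vf_W'_def vf_Z_def vf_Z'_def vec_eq_iff forall_4 Let_def
    coef_A_def coef_B_def coef_P_def coef_Q_def
  by (simp_all add: axis_def)

lemma f_sq_eq: "f_sq q p = - (p $ 3 * coef_A q p)"
  unfolding f_sq_def vf_eq_tetrad[where q = q and p = p] coord_vol_def det_4
  by (simp add: tetrad_def)

lemma kdv_domain_iff: "p \<in> kdv_domain U q \<longleftrightarrow> xz p \<in> U \<and> p $ 3 \<noteq> 0 \<and> coef_A q p \<noteq> 0"
  unfolding kdv_domain_def f_sq_eq by simp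

lemma kdv_coframe_eq:
  assumes "p \<in> kdv_domain U q"
  shows "kdv_coframe q p = cotetrad (p $ 3) (coef_A q p) (coef_B q p) (coef_P q p) (coef_Q q p)"
proof -
  have "(vector [vf_W q p, vf_W' p, vf_Z q p, vf_Z' p] :: real ^ 4 ^ 4) = kdv_tetrad q p"
    unfolding vec_eq_iff[of _ "kdv_tetrad q p"] forall_4 vector_4 vf_eq_tetrad[where q = q and p = p] by simp
  then show ?thesis
    unfolding kdv_coframe_def using assms dual_coframe_tetrad by (simp add: kdv_domain_iff)
qed

lemma kdv_metric_eq:
  assumes "p \<in> kdv_domain U q"
  shows "kdv_metric q p = tetrad_metric (p $ 3) (coef_A q p) (coef_B q p) (coef_P q p) (coef_Q q p)"
  using assms tetrad_metric_cotetrad[of "p $ 3" "coef_A q p"]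
  unfolding kdv_metric_def e_W_def e_W'_def e_Z_def e_Z'_def kdv_coframe_eq[OF assms] f_sq_eq
  by (simp add: kdv_domain_iff)

text \<open>Turns the orientation given by two-forms into a sign condition. The form built from e_W
  and e_Z alone forces the sign; conversely that sign makes all three anti-self-dual.\<close>

lemma kdv_orientation_iff:
  assumes "open U" "smooth_on U q"
  shows "kdv_orientation U q \<epsilon> \<longleftrightarrow> orientation_on (kdv_domain U q) \<epsilon> \<and>
    (\<forall>p\<in>kdv_domain U q. \<epsilon> p * \<bar>p $ 3 * coef_A q p\<bar> = p $ 3 * coef_A q p)"
proof -
  let ?D = "kdv_domain U q"
  have "(\<forall>F \<in> {f_sq q p *\<^sub>R wedge (e_W q p) (e_Z q p),
         f_sq q p *\<^sub>R (wedge (e_W q p) (e_W' q p) - wedge (e_Z q p) (e_Z' q p)),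
         f_sq q p *\<^sub>R wedge (e_W' q p) (e_Z' q p)}. anti_self_dual2 (kdv_metric q p) (\<epsilon> p) F)
      \<longleftrightarrow> \<epsilon> p * \<bar>p $ 3 * coef_A q p\<bar> = p $ 3 * coef_A q p"
    if p: "p \<in> ?D" and \<epsilon>: "\<epsilon> p = 1 \<or> \<epsilon> p = - 1" for p
    using p
      anti_self_dual_tetrad_metric[where m = "p $ 3" and A = "coef_A q p" and \<epsilon> = "\<epsilon> p"]
      anti_self_dual_tetrad_metric_imp_orientation[where m = "p $ 3" and A = "coef_A q p", OF _ _ \<epsilon>]
    unfolding e_W_def e_W'_def e_Z_def e_Z'_def kdv_coframe_eq[OF p] f_sq_eq kdv_metric_eq[OF p]
      kdv_domain_iff
    by blast
  then show ?thesis
    unfolding kdv_orientation_def orientation_on_def by (smt (verit, best))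
qed

locale kdv_potential =
  fixes U :: "(real ^ 2) set" and q :: "real ^ 2 \<Rightarrow> real"
  assumes open_U: "open U" and smooth_q: "smooth_on U q"
begin

abbreviation "cylinder \<equiv> xz -` U"

lemma open_cylinder: "open cylinder"
  by (rule open_vimage[OF open_U continuous_on_xz])

lemma smooth_b: "smooth_on U (kdv_b q)"
  unfolding kdv_b_def[abs_def] by (intro smooth_on_intros open_U smooth_q)

lemma smooth_w: "smooth_on U (kdv_w q)"
  unfolding kdv_w_def[abs_def] by (intro smooth_on_intros open_U smooth_q) simp

lemma smooth_coefs:
  "smooth_on cylinder (coef_A q)" "smooth_on cylinder (coef_B q)"
  "smooth_on cylinder (coef_P q)" "smooth_on cylinder (coef_Q q)"
  unfolding coef_A_def[abs_def] coef_B_def[abs_def] coef_P_def[abs_def] coef_Q_def[abs_def]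
  by (intro smooth_on_intros open_cylinder smooth_on_xz[OF open_U open_cylinder] smooth_q
      smooth_b smooth_w; auto)+

lemma open_domain: "open (kdv_domain U q)"
proof -
  have "kdv_domain U q = {p \<in> cylinder. p $ 3 * coef_A q p \<in> - {0}}"
    by (auto simp: kdv_domain_iff)
  also have "\<dots> = cylinder \<inter> (\<lambda>p. p $ 3 * coef_A q p) -` (- {0})" by blast
  also have "open \<dots>"
    by (intro continuous_open_preimage open_cylinder continuous_intros
        smooth_on_continuous_on[OF smooth_coefs(1)])
  finally show ?thesis .
qed

lemma domain_subset: "kdv_domain U q \<subseteq> cylinder"
  by (auto simp: kdv_domain_iff)

sublocale null_tetrad "kdv_domain U q" "kdv_metric q" "coef_A q" "coef_B q" "coef_P q" "coef_Q q"
  by unfold_locales (auto intro: open_domain smooth_on_subset[OF smooth_coefs(1) domain_subset]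
      smooth_on_subset[OF smooth_coefs(2) domain_subset] smooth_on_subset[OF smooth_coefs(3) domain_subset]
      smooth_on_subset[OF smooth_coefs(4) domain_subset] kdv_metric_eq simp: kdv_domain_iff)

lemma ultrahyperbolic_kdv_metric: "ultrahyperbolic_metric_on (kdv_domain U q) (kdv_metric q)"
  unfolding ultrahyperbolic_metric_on_def
  using smooth_g by (auto simp: kdv_metric_eq kdv_domain_iff intro!: ultrahyperbolic_tetrad_metric)

lemma orientation_exists: "\<exists>\<epsilon>. kdv_orientation U q \<epsilon>"
proof -
  let ?f = "\<lambda>p. p $ 3 * coef_A q p"
  \<comment> \<open>The sign of m A, written as a quotient so that its continuity follows from that
    of m A, which has no zero on the domain.\<close>
  have "continuous_on (kdv_domain U q) (\<lambda>p. ?f p / \<bar>?f p\<bar>)"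
    by (intro continuous_intros smooth_on_continuous_on[OF smooth(1)]) (auto simp: kdv_domain_iff)
  then have "orientation_on (kdv_domain U q) (\<lambda>p. ?f p / \<bar>?f p\<bar>)"
    unfolding orientation_on_def by (auto simp: kdv_domain_iff abs_if)
  then show ?thesis
    unfolding kdv_orientation_iff[OF open_U smooth_q]
    by (intro exI[of _ "\<lambda>p. ?f p / \<bar>?f p\<bar>"]) (auto simp: kdv_domain_iff)
qed

section \<open>Derivatives of the potential and of the tetrad coefficients\<close>

lemma partial_b:
  assumes y: "y \<in> U"
  shows "partial i (kdv_b q) y = partial i (partial 1 q) y - 2 * q y * partial i q y"
  unfolding kdv_b_def[abs_def]
  by (intro has_partial_imp_partial has_partial_diff has_partial_power2
      smooth_on_has_partial[OF open_U _ y] smooth_on_partial smooth_q)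

lemma partial_11_b:
  assumes y: "y \<in> U"
  shows "partial 1 (partial 1 (kdv_b q)) y = partial 1 (partial 1 (partial 1 q)) y
    - 2 * (partial 1 q y)\<^sup>2 - 2 * q y * partial 1 (partial 1 q) y"
proof -
  have "partial 1 (partial 1 (kdv_b q)) y =
      partial 1 (\<lambda>y. partial 1 (partial 1 q) y - 2 * q y * partial 1 q y) y"
    by (rule partial_cong_on[OF open_U y]) (rule partial_b)
  also have "\<dots> = partial 1 (partial 1 (partial 1 q)) y
      - ((0 * q y + 2 * partial 1 q y) * partial 1 q y + 2 * q y * partial 1 (partial 1 q) y)"
    by (intro has_partial_imp_partial has_partial_diff has_partial_mult has_partial_const
        smooth_on_has_partial[OF open_U _ y] smooth_on_partial smooth_q)
  finally show ?thesis by (simp add: power2_eq_square algebra_simps)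
qed

lemma partial_1_w:
  assumes y: "y \<in> U"
  shows "4 * partial 1 (kdv_w q) y = partial 1 (partial 1 (partial 1 (partial 1 q))) y
    - 8 * partial 1 q y * partial 1 (partial 1 q) y - 4 * q y * partial 1 (partial 1 (partial 1 q)) y
    + 8 * q y * (partial 1 q y)\<^sup>2 + 4 * (q y)\<^sup>2 * partial 1 (partial 1 q) y"
proof -
  note hp = smooth_on_has_partial[OF open_U _ y, where i=1]
  \<comment> \<open>The zero terms and the division by 4^2 are the raw output of the product and
    quotient rules; keeping them lets the rules apply by matching.\<close>
  have "has_partial 1 (kdv_w q) ((partial 1 (partial 1 (partial 1 (partial 1 q))) y
      - ((0 * q y + 4 * partial 1 q y) * partial 1 (partial 1 q) y
         + 4 * q y * partial 1 (partial 1 (partial 1 q)) y)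
      - (0 * (partial 1 q y)\<^sup>2 + 2 * (2 * partial 1 q y * partial 1 (partial 1 q) y))
      + ((0 * (q y)\<^sup>2 + 4 * (2 * q y * partial 1 q y)) * partial 1 q y
         + 4 * (q y)\<^sup>2 * partial 1 (partial 1 q) y)) / 4
      - (partial 1 (partial 1 (partial 1 q)) y - 4 * q y * partial 1 (partial 1 q) y
         - 2 * (partial 1 q y)\<^sup>2 + 4 * (q y)\<^sup>2 * partial 1 q y) * 0 / 4\<^sup>2) y"
    unfolding kdv_w_def[abs_def]
    by (intro has_partial_divide has_partial_add has_partial_diff has_partial_mult
        has_partial_power2 has_partial_const hp smooth_on_partial smooth_q) simp
  from has_partial_imp_partial[OF this] show ?thesis
    by (simp add: power2_eq_square algebra_simps)
qed

text \<open>This is KdV for u = - q_x up to sign. Exchanging the derivatives lets the potential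
  equation be substituted for q_z before the x-derivative is taken.\<close>

lemma partial_21_q:
  assumes y: "y \<in> U" and pot: "normalised_potential_on U q"
  shows "4 * partial 2 (partial 1 q) y = partial 1 (partial 1 (partial 1 (partial 1 q))) y
    - 12 * partial 1 q y * partial 1 (partial 1 q) y"
proof -
  have "partial 2 (partial 1 q) y = partial 1 (partial 2 q) y"
    by (rule partial_commute[OF open_U smooth_q y])
  also have "\<dots> = partial 1 (\<lambda>y. (partial 1 (partial 1 (partial 1 q)) y - 6 * (partial 1 q y)\<^sup>2) / 4) y"
    using pot unfolding normalised_potential_on_def
    by (intro partial_cong_on[OF open_U y]) (auto simp: field_simps)
  also have "\<dots> = (partial 1 (partial 1 (partial 1 (partial 1 q))) y
      - (0 * (partial 1 q y)\<^sup>2 + 6 * (2 * partial 1 q y * partial 1 (partial 1 q) y))) / 4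
      - (partial 1 (partial 1 (partial 1 q)) y - 6 * (partial 1 q y)\<^sup>2) * 0 / 4\<^sup>2"
    by (intro has_partial_imp_partial has_partial_divide has_partial_diff has_partial_mult
        has_partial_power2 has_partial_const smooth_on_has_partial[OF open_U _ y]
        smooth_on_partial smooth_q) simp
  finally show ?thesis by simp
qed

text \<open>All four coefficients are linear in (m, n) over functions of (x, z), so one computation
  covers them.\<close>

lemma has_partial_affine:
  assumes y: "xz p \<in> U" and F: "smooth_on U F" and G: "smooth_on U G"
  shows "has_partial 1 (\<lambda>p. F (xz p) * p $ 3 + G (xz p) * p $ 4)
      (partial 1 F (xz p) * p $ 3 + partial 1 G (xz p) * p $ 4) p"
    "has_partial 2 (\<lambda>p. F (xz p) * p $ 3 + G (xz p) * p $ 4)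
      (partial 2 F (xz p) * p $ 3 + partial 2 G (xz p) * p $ 4) p"
    "has_partial 3 (\<lambda>p. F (xz p) * p $ 3 + G (xz p) * p $ 4) (F (xz p)) p"
    "has_partial 4 (\<lambda>p. F (xz p) * p $ 3 + G (xz p) * p $ 4) (G (xz p)) p"
proof -
  have xz: "has_partial i (\<lambda>p. f (xz p)) (partial i (\<lambda>p. f (xz p)) p) p" if "smooth_on U f" for f and i :: 4
    by (rule smooth_on_has_partial[OF open_cylinder smooth_on_xz[OF open_U open_cylinder that]])
      (use y in auto)
  have "has_partial i (\<lambda>p. F (xz p) * p $ 3 + G (xz p) * p $ 4)
     ((partial i (\<lambda>p. F (xz p)) p * p $ 3 + F (xz p) * (if i = 3 then 1 else 0))
      + (partial i (\<lambda>p. G (xz p)) p * p $ 4 + G (xz p) * (if i = 4 then 1 else 0))) p" for i :: 4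
    by (intro has_partial_add has_partial_mult has_partial_coord xz F G)
  from this[of 1] this[of 2] this[of 3] this[of 4]
  show "has_partial 1 (\<lambda>p. F (xz p) * p $ 3 + G (xz p) * p $ 4)
      (partial 1 F (xz p) * p $ 3 + partial 1 G (xz p) * p $ 4) p"
    "has_partial 2 (\<lambda>p. F (xz p) * p $ 3 + G (xz p) * p $ 4)
      (partial 2 F (xz p) * p $ 3 + partial 2 G (xz p) * p $ 4) p"
    "has_partial 3 (\<lambda>p. F (xz p) * p $ 3 + G (xz p) * p $ 4) (F (xz p)) p"
    "has_partial 4 (\<lambda>p. F (xz p) * p $ 3 + G (xz p) * p $ 4) (G (xz p)) p"
    by (simp_all add: partial_xz)
qed

lemma partial_const_mult:
  "smooth_on U F \<Longrightarrow> y \<in> U \<Longrightarrow> partial i (\<lambda>y. c * F y) y = c * partial i F y"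
  using has_partial_mult[OF has_partial_const smooth_on_has_partial[OF open_U]]
    has_partial_imp_partial by fastforce

lemma partial_coefs:
  assumes y: "xz p \<in> U"
  shows "partial 1 (coef_A q) p = partial 1 q (xz p) * p $ 3"
    "partial 2 (coef_A q) p = partial 2 q (xz p) * p $ 3"
    "partial 3 (coef_A q) p = q (xz p)" "partial 4 (coef_A q) p = 1"
    "partial 1 (coef_B q) p = partial 1 (kdv_b q) (xz p) * p $ 3 - partial 1 q (xz p) * p $ 4"
    "partial 2 (coef_B q) p = partial 2 (kdv_b q) (xz p) * p $ 3 - partial 2 q (xz p) * p $ 4"
    "partial 3 (coef_B q) p = kdv_b q (xz p)" "partial 4 (coef_B q) p = - q (xz p)"
    "partial 1 (coef_P q) p = partial 1 (partial 1 (kdv_b q)) (xz p) / 2 * p $ 3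
       - partial 1 (partial 1 q) (xz p) * p $ 4"
    "partial 3 (coef_P q) p = partial 1 (kdv_b q) (xz p) / 2" "partial 4 (coef_P q) p = - partial 1 q (xz p)"
    "partial 1 (coef_Q q) p = partial 1 (kdv_w q) (xz p) * p $ 3
       - partial 1 (partial 1 (kdv_b q)) (xz p) / 2 * p $ 4"
    "partial 3 (coef_Q q) p = kdv_w q (xz p)" "partial 4 (coef_Q q) p = - partial 1 (kdv_b q) (xz p) / 2"
proof -
  \<comment> \<open>Signs and halves become factors inside the function multiplying m or n, to match
    the pattern of \<open>has_partial_affine\<close>.\<close>
  have eqs: "coef_A q = (\<lambda>p. q (xz p) * p $ 3 + 1 * p $ 4)"
    "coef_B q = (\<lambda>p. kdv_b q (xz p) * p $ 3 + (- 1 * q (xz p)) * p $ 4)"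
    "coef_P q = (\<lambda>p. (1 / 2 * partial 1 (kdv_b q) (xz p)) * p $ 3 + (- 1 * partial 1 q (xz p)) * p $ 4)"
    "coef_Q q = (\<lambda>p. kdv_w q (xz p) * p $ 3 + (- 1 / 2 * partial 1 (kdv_b q) (xz p)) * p $ 4)"
    by (simp_all add: fun_eq_iff coef_A_def coef_B_def coef_P_def coef_Q_def)
  note smooths = smooth_q smooth_b smooth_w smooth_on_partial[OF smooth_q] smooth_on_partial[OF smooth_b]
  have scaled: "smooth_on U (\<lambda>y. c * F y)" if "smooth_on U F" for c F
    using that open_U by (intro smooth_on_intros)
  note a = has_partial_affine[OF y, THEN has_partial_imp_partial]
  note A = a[OF smooth_q smooth_on_const[of U 1]]
    and B = a[OF smooth_b scaled[OF smooth_q, of "- 1"]]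
    and P = a[OF scaled[OF smooth_on_partial[OF smooth_b], of "1 / 2"]
          scaled[OF smooth_on_partial[OF smooth_q], of "- 1"]]
    and Q = a[OF smooth_w scaled[OF smooth_on_partial[OF smooth_b], of "- 1 / 2"]]
  have c: "partial i (\<lambda>y. 1) y = 0" for i :: 2 and y
    by (rule has_partial_imp_partial[OF has_partial_const])
  show "partial 1 (coef_A q) p = partial 1 q (xz p) * p $ 3"
    "partial 2 (coef_A q) p = partial 2 q (xz p) * p $ 3"
    "partial 3 (coef_A q) p = q (xz p)" "partial 4 (coef_A q) p = 1"
    unfolding eqs A c by simp_all
  show "partial 1 (coef_B q) p = partial 1 (kdv_b q) (xz p) * p $ 3 - partial 1 q (xz p) * p $ 4"
    "partial 2 (coef_B q) p = partial 2 (kdv_b q) (xz p) * p $ 3 - partial 2 q (xz p) * p $ 4"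
    "partial 3 (coef_B q) p = kdv_b q (xz p)" "partial 4 (coef_B q) p = - q (xz p)"
    unfolding eqs B partial_const_mult[OF smooth_q y] by simp_all
  show "partial 1 (coef_P q) p = partial 1 (partial 1 (kdv_b q)) (xz p) / 2 * p $ 3
       - partial 1 (partial 1 q) (xz p) * p $ 4"
    "partial 3 (coef_P q) p = partial 1 (kdv_b q) (xz p) / 2" "partial 4 (coef_P q) p = - partial 1 q (xz p)"
    unfolding eqs P partial_const_mult[OF smooth_on_partial[OF smooth_q] y]
      partial_const_mult[OF smooth_on_partial[OF smooth_b] y] by simp_all
  show "partial 1 (coef_Q q) p = partial 1 (kdv_w q) (xz p) * p $ 3
       - partial 1 (partial 1 (kdv_b q)) (xz p) / 2 * p $ 4"
    "partial 3 (coef_Q q) p = kdv_w q (xz p)" "partial 4 (coef_Q q) p = - partial 1 (kdv_b q) (xz p) / 2"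
    unfolding eqs Q partial_const_mult[OF smooth_on_partial[OF smooth_b] y] by simp_all
qed

text \<open>The first two relations say that [W, W'] + [Z', Z] = 0, and the next two that the linear
  parts of W and Z are trace-free; these hold identically in q. The last two are the components of
  [W, Z] = 0 after the trace conditions are inserted, and there the equation for q enters.\<close>

lemma closed_null_tetrad:
  assumes pot: "normalised_potential_on U q"
  shows "closed_null_tetrad (kdv_domain U q) (kdv_metric q) (coef_A q) (coef_B q) (coef_P q) (coef_Q q)"
proof unfold_locales
  fix p assume "p \<in> kdv_domain U q"
  then have y: "xz p \<in> U" by (simp add: kdv_domain_iff)
  note d = partial_coefs[OF y] coef_A_def[of q p] coef_B_def[of q p] coef_P_def[of q p] coef_Q_def[of q p]
  show "partial 1 (coef_A q) p = - (p $ 3 * partial 4 (coef_P q) p)"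
    "partial 1 (coef_B q) p = coef_P q p + p $ 3 * partial 3 (coef_P q) p"
    "partial 4 (coef_B q) p = - partial 3 (coef_A q) p"
    "partial 4 (coef_Q q) p = - partial 3 (coef_P q) p"
    unfolding d by simp_all
  have z: "partial 2 q (xz p) = (partial 1 (partial 1 (partial 1 q)) (xz p) - 6 * (partial 1 q (xz p))\<^sup>2) / 4"
    using pot y unfolding normalised_potential_on_def by (auto simp: field_simps)
  have xz: "partial 2 (partial 1 q) (xz p) = (partial 1 (partial 1 (partial 1 (partial 1 q))) (xz p)
      - 12 * partial 1 q (xz p) * partial 1 (partial 1 q) (xz p)) / 4"
    using partial_21_q[OF y pot] by simp
  have w: "partial 1 (kdv_w q) (xz p) = (partial 1 (partial 1 (partial 1 (partial 1 q))) (xz p)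
      - 8 * partial 1 q (xz p) * partial 1 (partial 1 q) (xz p)
      - 4 * q (xz p) * partial 1 (partial 1 (partial 1 q)) (xz p)
      + 8 * q (xz p) * (partial 1 q (xz p))\<^sup>2 + 4 * (q (xz p))\<^sup>2 * partial 1 (partial 1 q) (xz p)) / 4"
    using partial_1_w[OF y] by simp
  note jets = partial_b[OF y] partial_11_b[OF y] w z xz
  show "partial 1 (coef_Q q) p = partial 2 (coef_B q) p
       - (partial 3 (coef_A q) p * coef_Q q p + coef_A q p * partial 3 (coef_Q q) p
          - partial 3 (coef_B q) p * coef_P q p - coef_B q p * partial 3 (coef_P q) p)"
    unfolding d unfolding jets kdv_b_def kdv_w_def by (simp add: field_simps power2_eq_square)
  \<comment> \<open>The coefficients of n agree identically; those of m agree exactly when 4 q_z =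
    q_xxx - 6 q_x^2. Here q_z occurs undifferentiated, so a function of z added to the equation
    would break the relation.\<close>
  show "partial 1 (coef_P q) p = partial 2 (coef_A q) p
       + (partial 4 (coef_A q) p * coef_Q q p - coef_A q p * partial 3 (coef_P q) p
          + partial 3 (coef_A q) p * coef_P q p - coef_B q p * partial 4 (coef_P q) p)"
    unfolding d unfolding jets kdv_b_def kdv_w_def by (simp add: field_simps power2_eq_square)
qed

end

text \<open>The metric depends on q itself, which u determines only up to a function of z; [W, Z] =
  0 fixes that freedom, whence the normalisation in the half-flatness clause. The existence of an
  orientation keeps the quantification over \<open>\<epsilon>\<close> in that clause from being
  vacuous.\<close>

theorem mainTheorem3:
  fixes U :: "(real ^ 2) set" and q :: "real ^ 2 \<Rightarrow> real"
  assumes "open U"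
    and "smooth_on U q"
    and "kdv_on U (\<lambda>y. - partial 1 q y)"
  shows "(\<forall>p. xz p \<in> U \<longrightarrow> f_sq q p = - (p $ 3) * (q (xz p) * p $ 3 + p $ 4))
    \<and> ultrahyperbolic_metric_on (kdv_domain U q) (kdv_metric q)
    \<and> (\<forall>p\<in>kdv_domain U q. \<forall>f :: complex. f\<^sup>2 = of_real (f_sq q p) \<longrightarrow>
        normalised_null_tetrad (kdv_metric q p)
          (complex_scale (inverse f) (vf_W q p)) (complex_scale (inverse f) (vf_W' p))
          (complex_scale (inverse f) (vf_Z q p)) (complex_scale (inverse f) (vf_Z' p)))
    \<and> (\<exists>\<epsilon>. kdv_orientation U q \<epsilon>)
    \<and> (normalised_potential_on U q \<longrightarrow>
        (\<forall>\<epsilon>. kdv_orientation U q \<epsilon> \<longrightarrow> half_flat_on (kdv_domain U q) \<epsilon> (kdv_metric q)))"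
proof -
  interpret kdv_potential U q
    using assms by unfold_locales
  have f_sq: "f_sq q p = - (p $ 3) * (q (xz p) * p $ 3 + p $ 4)" for p
    by (simp add: f_sq_eq coef_A_def)
  have "normalised_null_tetrad (kdv_metric q p)
      (complex_scale (inverse f) (vf_W q p)) (complex_scale (inverse f) (vf_W' p))
      (complex_scale (inverse f) (vf_Z q p)) (complex_scale (inverse f) (vf_Z' p))"
    if p: "p \<in> kdv_domain U q" and f: "f\<^sup>2 = of_real (f_sq q p)" for p and f :: complex
    unfolding kdv_metric_eq[OF p] vf_eq_tetrad[where q = q and p = p]
    using p f unfolding kdv_domain_iff f_sq_eq by (intro normalised_null_tetrad_tetrad) auto
  moreover have "half_flat_on (kdv_domain U q) \<epsilon> (kdv_metric q)"
    if "normalised_potential_on U q" and "kdv_orientation U q \<epsilon>" for \<epsilon>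
    using closed_null_tetrad.half_flat[OF closed_null_tetrad[OF that(1)]] that(2)
    unfolding kdv_orientation_iff[OF assms(1,2)] by blast
  ultimately show ?thesis
    using f_sq ultrahyperbolic_kdv_metric orientation_exists by blast
qed

end
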